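(* Let $s\in(0,1)$ and $0\le r\le s$. For all $\eta\in H^{s+r}(\mathbb R^d)$ and $\theta\in H^{s-r}(\mathbb R^d)$, $$\big((-\Delta)^{(s+r)/2}\eta,\,(-\Delta)^{(s-r)/2}\theta\big)=c_s\int_0^\infty t^{2-2s}\,\big(-\Delta(I-t^2\Delta)^{-1}\eta,\theta\big)\,\frac{dt}{t},$$ where $$c_s:=\bigg(\int_0^\infty\frac{y^{1-2s}}{1+y^2}\,dy\bigg)^{-1}=\frac{2\sin(\pi s)}{\pi}.$$
   Context: $(\cdot,\cdot)$ is the $L^2(\mathbb R^d)$ inner product (conjugate on the second argument if functions are complex valued). $\mathcal F$ is the unitary Fourier transform on $L^2(\mathbb R^d)$. For $r\ge 0$, $H^{r}(\mathbb R^d)$ is the set of $f\in L^2(\mathbb R^d)$ with $(1+|\zeta|^2)^{r/2}\mathcal F(f)\in L^2(\mathbb R^d)$. For $\sigma\ge 0$, $(-\Delta)^\sigma$ is the unbounded operator on $L^2(\mathbb R^d)$ defined by $\mathcal F((-\Delta)^\sigma f)(\zeta)=|\zeta|^{2\sigma}\mathcal F(f)(\zeta)$ for those $f\in L^2(\mathbb R^d)$ with $|\zeta|^{2\sigma}\mathcal F(f)\in L^2(\mathbb R^d)$. For $t>0$, $(I-t^2\Delta)^{-1}$ is the bounded map from $L^2(\mathbb R^d)$ to $H^2(\mathbb R^d)$ with Fourier multiplier $(1+t^2|\zeta|^2)^{-1}$, so that $-\Delta(I-t^2\Delta)^{-1}$ is bounded on $L^2(\mathbb R^d)$. *)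

theory Defs
  imports "HOL-Analysis.Analysis"
begin

text \<open>
  Euclidean space is an arbitrary type \<open>'a :: euclidean_space\<close>, with \<open>d = DIM('a) \<ge> 1\<close>.
  Elements of \<open>L\<^sup>2\<close> are represented by Borel functions; every class of Lebesgue
  measurable functions modulo null sets contains one. All notions below are invariant under
  changes on null sets, and operators with values in \<open>L\<^sup>2\<close> return some representative.
\<close>

definition L2 :: "('a::euclidean_space \<Rightarrow> complex) set" where
  "L2 = {f \<in> borel_measurable lborel. integrable lborel (\<lambda>x. (cmod (f x))\<^sup>2)}"

definition L2_inner ::
  "('a::euclidean_space \<Rightarrow> complex) \<Rightarrow> ('a \<Rightarrow> complex) \<Rightarrow> complex" where
  "L2_inner f g = (LBINT x. f x * cnj (g x))"

definition truncated_fourier ::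
  "nat \<Rightarrow> ('a::euclidean_space \<Rightarrow> complex) \<Rightarrow> 'a \<Rightarrow> complex" where
  "truncated_fourier n f \<zeta> =
     complex_of_real ((2 * pi) powr (- real DIM('a) / 2)) *
     (LBINT x:cball 0 n. f x * exp (- (\<i> * complex_of_real (x \<bullet> \<zeta>))))"

text \<open>
  The unitary Fourier transform on \<open>L\<^sup>2\<close>: the \<open>L\<^sup>2\<close> limit of the Fourier integrals over
  balls of growing radius (\<open>f\<close> is integrable on each ball). Convergence is expressed
  with the nonnegative integral, which does not vanish on non-integrable functions.
  With this normalisation \<open>-\<Delta>\<close> has the symbol \<open>|\<zeta>|\<^sup>2\<close>.
\<close>

definition fourier :: "('a::euclidean_space \<Rightarrow> complex) \<Rightarrow> 'a \<Rightarrow> complex" where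
  "fourier f = (SOME g. g \<in> L2 \<and>
     (\<lambda>n. \<integral>\<^sup>+ \<zeta>. ennreal ((cmod (truncated_fourier n f \<zeta> - g \<zeta>))\<^sup>2) \<partial>lborel)
       \<longlonglongrightarrow> 0)"

definition sobolev :: "real \<Rightarrow> ('a::euclidean_space \<Rightarrow> complex) set" where
  "sobolev r = {f \<in> L2.
     (\<lambda>\<zeta>. complex_of_real ((1 + (norm \<zeta>)\<^sup>2) powr (r / 2)) * fourier f \<zeta>) \<in> L2}"

text \<open>
  The operator with symbol \<open>m\<close>. A function \<open>g\<close> as below exists precisely if \<open>f\<close> is in the
  domain of the operator, that is, if \<open>m\<close> times the transform of \<open>f\<close> is in \<open>L\<^sup>2\<close>;
  outside the domain the value is unspecified.
\<close>

definition fourier_multiplier ::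
  "('a \<Rightarrow> real) \<Rightarrow> ('a::euclidean_space \<Rightarrow> complex) \<Rightarrow> 'a \<Rightarrow> complex" where
  "fourier_multiplier m f = (SOME g. g \<in> L2 \<and>
     (AE \<zeta> in lborel. fourier g \<zeta> = complex_of_real (m \<zeta>) * fourier f \<zeta>))"

text \<open>
  \<open>(-\<Delta>)\<^sup>\<sigma>\<close>. For \<open>\<sigma> = 0\<close> the symbol is \<open>1\<close> except at the origin, where
  \<open>0 powr 0 = 0\<close>; this null set does not matter.
\<close>

definition frac_laplacian ::
  "real \<Rightarrow> ('a::euclidean_space \<Rightarrow> complex) \<Rightarrow> 'a \<Rightarrow> complex" where
  "frac_laplacian \<sigma> = fourier_multiplier (\<lambda>\<zeta>. norm \<zeta> powr (2 * \<sigma>))"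

text \<open>\<open>(I - t\<^sup>2 \<Delta>)\<close> inverted, for \<open>t > 0\<close>.\<close>

definition laplace_resolvent ::
  "real \<Rightarrow> ('a::euclidean_space \<Rightarrow> complex) \<Rightarrow> 'a \<Rightarrow> complex" where
  "laplace_resolvent t = fourier_multiplier (\<lambda>\<zeta>. inverse (1 + t\<^sup>2 * (norm \<zeta>)\<^sup>2))"

definition c_const :: "real \<Rightarrow> real" where
  "c_const s = inverse (LBINT y:{0<..}. y powr (1 - 2 * s) / (1 + y\<^sup>2))"

end

theory Submission
  imports Defs "HOL-Probability.Characteristic_Functions"
begin

text \<open>
  By Parseval's identity, both sides become integrals over the frequency \<open>\<zeta>\<close> of \<open>fourier \<eta>\<close> times the
  conjugate of \<open>fourier \<theta>\<close>, with weights \<open>|\<zeta>|\<^sup>2\<^sup>s\<close> and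
  \<open>\<integral>\<^sub>0\<^sup>\<infinity> t\<^sup>1\<^sup>-\<^sup>2\<^sup>s |\<zeta>|\<^sup>2 / (1 + t\<^sup>2 |\<zeta>|\<^sup>2) dt\<close>; scaling \<open>y = t |\<zeta>|\<close> shows that
  the latter is \<open>|\<zeta>|\<^sup>2\<^sup>s\<close> over \<open>c\<^sub>s\<close>, and Fubini's theorem applies because \<open>|\<zeta>|\<^sup>2\<^sup>s\<close> times the two
  transforms is integrable.

  Plancherel's theorem is obtained by inserting a Gaussian weight into \<open>\<integral> |fourier h|\<^sup>2\<close>, which by
  the multiplication formula equals an inner product of \<open>h\<close> with its Gaussian averages. These are
  bounded by \<open>h\<close> in \<open>L\<^sup>2\<close> (whence the transform extends to \<open>L\<^sup>2\<close>) and tend weakly to \<open>h\<close> (whence it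
  preserves inner products). Together with the multiplication formula this also yields
  inversion, and so the existence of the functions that define Fourier multipliers.
\<close>

section \<open>Square integrable functions\<close>

text \<open>The parameter r only distributes the weight |\<zeta>|^(2s) between the two functions.
  For r = s the function \<open>\<theta>\<close> is merely in L2, so integrability of the weighted
  product has to come from pairing |\<zeta>|^(s+r) \<open>fourier \<eta>\<close> with
  |\<zeta>|^(s-r) \<open>fourier \<theta>\<close>, both in L2. The transform and the operators are
  defined by choice, so each must first be shown to exist: completeness of L2 serves the transform,
  surjectivity of the transform serves the multipliers, and the resulting identities hold only
  almost everywhere. In Plancherel's theorem the inequality precedes the identity: as long as the
  transform is not known to lie in L2, the Gaussian weight is removed by Fatou's lemma; afterwards
  dominated convergence is available. The range 0 < s < 1 is where y^(1-2s) / (1 + y^2) is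
  integrable, at 0 by s < 1 and at infinity by s > 0.\<close>

definition sqnorm :: "('a::euclidean_space \<Rightarrow> complex) \<Rightarrow> ennreal" where
  "sqnorm f = (\<integral>\<^sup>+ x. ennreal ((cmod (f x))\<^sup>2) \<partial>lborel)"

lemma L2_measurable [measurable_dest]: "f \<in> L2 \<Longrightarrow> f \<in> borel_measurable borel"
  by (simp add: L2_def)

lemma L2_iff_sqnorm: "f \<in> L2 \<longleftrightarrow> f \<in> borel_measurable borel \<and> sqnorm f < \<infinity>"
proof -
  have "integrable lborel (\<lambda>x. (cmod (f x))\<^sup>2) \<longleftrightarrow> sqnorm f < \<infinity>"
    if [measurable]: "f \<in> borel_measurable borel"
    by (simp add: integrable_iff_bounded sqnorm_def)
  then show ?thesis
    by (auto simp: L2_def)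
qed

lemma L2_sqnorm_finite: "f \<in> L2 \<Longrightarrow> sqnorm f < \<infinity>"
  by (simp add: L2_iff_sqnorm)

lemma L2I_sqnorm: "f \<in> borel_measurable borel \<Longrightarrow> sqnorm f < \<infinity> \<Longrightarrow> f \<in> L2"
  by (simp add: L2_iff_sqnorm)

lemma sqnorm_eq_integral: "f \<in> L2 \<Longrightarrow> sqnorm f = ennreal (LBINT x. (cmod (f x))\<^sup>2)"
  unfolding sqnorm_def by (rule nn_integral_eq_integral) (auto simp: L2_def)

lemma sqnorm_mono: "(\<And>x. cmod (f x) \<le> cmod (g x)) \<Longrightarrow> sqnorm f \<le> sqnorm g"
  unfolding sqnorm_def by (intro nn_integral_mono ennreal_leI power_mono) auto

lemma sqnorm_cong: "(\<And>x. cmod (f x) = cmod (g x)) \<Longrightarrow> sqnorm f = sqnorm g"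
  unfolding sqnorm_def by simp

lemma sqnorm_minus_commute: "sqnorm (\<lambda>x. f x - g x) = sqnorm (\<lambda>x. g x - f x)"
  by (rule sqnorm_cong) (simp add: norm_minus_commute)

lemma L2_dominated:
  assumes "f \<in> L2" "g \<in> borel_measurable borel" "\<And>x. cmod (g x) \<le> cmod (f x)"
  shows "g \<in> L2"
  using assms sqnorm_mono[of g f] L2_sqnorm_finite[of f]
  by (intro L2I_sqnorm) (auto intro: le_less_trans)

text \<open>Transforms of multiplier images are determined only up to null sets, so their bounds are
  available only almost everywhere.\<close>

lemma L2_dominated_AE:
  assumes f: "f \<in> L2" and [measurable]: "g \<in> borel_measurable borel"
    and bound: "AE x in lborel. cmod (g x) \<le> C * cmod (f x)"
  shows "g \<in> L2"
proof (rule L2I_sqnorm)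
  note [measurable] = L2_measurable[OF f]
  have "sqnorm g \<le> (\<integral>\<^sup>+ x. ennreal (C\<^sup>2) * ennreal ((cmod (f x))\<^sup>2) \<partial>lborel)"
    unfolding sqnorm_def
  proof (rule nn_integral_mono_AE, use bound in eventually_elim)
    case (elim x)
    then have "(cmod (g x))\<^sup>2 \<le> (C * cmod (f x))\<^sup>2"
      by (intro power_mono) auto
    then show ?case
      by (simp add: power_mult_distrib ennreal_leI flip: ennreal_mult)
  qed
  also have "\<dots> = ennreal (C\<^sup>2) * sqnorm f"
    unfolding sqnorm_def by (simp add: nn_integral_cmult)
  also have "\<dots> < \<infinity>"
    using L2_sqnorm_finite[OF f] by (simp add: ennreal_mult_less_top)
  finally show "sqnorm g < \<infinity>" .
qed fact

text \<open>Norms are kept squared, so this replaces the triangle inequality; the factor 2 is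
  harmless in limits.\<close>

lemma sqnorm_add_le:
  assumes [measurable]: "f \<in> borel_measurable borel" "g \<in> borel_measurable borel"
  shows "sqnorm (\<lambda>x. f x + g x) \<le> 2 * sqnorm f + 2 * sqnorm g"
proof -
  have *: "(cmod (a + b))\<^sup>2 \<le> 2 * (cmod a)\<^sup>2 + 2 * (cmod b)\<^sup>2" for a b
  proof -
    have "(cmod (a + b))\<^sup>2 \<le> (cmod a + cmod b)\<^sup>2"
      by (intro power_mono norm_triangle_ineq) auto
    \<comment> \<open>The two sides differ by the square of \<open>cmod a - cmod b\<close>.\<close>
    also have "\<dots> \<le> 2 * (cmod a)\<^sup>2 + 2 * (cmod b)\<^sup>2"
      using sum_squares_ge_zero[of "cmod a - cmod b" 0] by (simp add: power2_eq_square algebra_simps)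
    finally show ?thesis .
  qed
  have "sqnorm (\<lambda>x. f x + g x) \<le> (\<integral>\<^sup>+ x. 2 * ennreal ((cmod (f x))\<^sup>2) + 2 * ennreal ((cmod (g x))\<^sup>2) \<partial>lborel)"
    unfolding sqnorm_def
  proof (intro nn_integral_mono)
    fix x
    show "ennreal ((cmod (f x + g x))\<^sup>2) \<le> 2 * ennreal ((cmod (f x))\<^sup>2) + 2 * ennreal ((cmod (g x))\<^sup>2)"
      using ennreal_leI[OF *[of "f x" "g x"]] by (simp add: ennreal_mult ennreal_plus)
  qed
  also have "\<dots> = 2 * sqnorm f + 2 * sqnorm g"
    unfolding sqnorm_def by (subst nn_integral_add) (auto simp: nn_integral_cmult)
  finally show ?thesis .
qed

lemma sqnorm_diff_le:
  assumes [measurable]: "f \<in> borel_measurable borel" "g \<in> borel_measurable borel"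
  shows "sqnorm (\<lambda>x. f x - g x) \<le> 2 * sqnorm f + 2 * sqnorm g"
  using sqnorm_add_le[of f "\<lambda>x. - g x"] by (simp add: sqnorm_def)

lemma L2_diff: "f \<in> L2 \<Longrightarrow> g \<in> L2 \<Longrightarrow> (\<lambda>x. f x - g x) \<in> L2"
  using sqnorm_diff_le[of f g] by (auto simp: L2_iff_sqnorm ennreal_mult_less_top elim!: le_less_trans)

lemma borel_measurable_cnj [measurable (raw)]:
  "f \<in> borel_measurable M \<Longrightarrow> (\<lambda>x. cnj (f x)) \<in> borel_measurable M"
  using measurable_compose[OF _ borel_measurable_continuous_onI[of cnj]] continuous_on_cnj[OF continuous_on_id]
  by blast

lemma L2_cnj: "f \<in> L2 \<Longrightarrow> (\<lambda>x. cnj (f x)) \<in> L2"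
  by (rule L2_dominated[of f]) (auto dest: L2_measurable)

lemma L2_integrable_mult:
  assumes "f \<in> L2" "g \<in> L2"
  shows "integrable lborel (\<lambda>x. f x * g x)"
proof (rule Bochner_Integration.integrable_bound[where f="\<lambda>x. (cmod (f x))\<^sup>2 + (cmod (g x))\<^sup>2"])
  note [measurable] = assms[THEN L2_measurable]
  show "(\<lambda>x. f x * g x) \<in> borel_measurable lborel"
    by measurable
  show "integrable lborel (\<lambda>x. (cmod (f x))\<^sup>2 + (cmod (g x))\<^sup>2)"
    using assms by (auto simp: L2_def)
  have "a * b \<le> a\<^sup>2 + b\<^sup>2" if "a \<ge> 0" "b \<ge> 0" for a b :: real
    using sum_squares_bound[of a b] mult_nonneg_nonneg[OF that] by linarith
  then show "AE x in lborel. norm (f x * g x) \<le> norm ((cmod (f x))\<^sup>2 + (cmod (g x))\<^sup>2)"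
    by (auto simp: norm_mult)
qed

lemma L2_inner_integrable:
  "f \<in> L2 \<Longrightarrow> g \<in> L2 \<Longrightarrow> integrable lborel (\<lambda>x. f x * cnj (g x))"
  by (intro L2_integrable_mult L2_cnj)

text \<open>Bilinear rather than sesquilinear, because the multiplication formula carries no
  conjugate; the inner product is the case of a conjugated second factor.\<close>

lemma L2_Cauchy_Schwarz:
  assumes "f \<in> L2" "g \<in> L2"
  shows "ennreal ((cmod (LBINT x. f x * g x))\<^sup>2) \<le> sqnorm f * sqnorm g"
proof -
  note [measurable] = assms[THEN L2_measurable]
  have "ennreal (cmod (LBINT x. f x * g x)) \<le> (\<integral>\<^sup>+ x. ennreal (cmod (f x)) * ennreal (cmod (g x)) \<partial>lborel)"
    using integral_norm_bound_ennreal[OF L2_integrable_mult[OF assms]]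
    by (simp add: norm_mult ennreal_mult)
  then have "(ennreal (cmod (LBINT x. f x * g x)))\<^sup>2
      \<le> (\<integral>\<^sup>+ x. ennreal (cmod (f x)) * ennreal (cmod (g x)) \<partial>lborel)\<^sup>2"
    by (rule power_mono) simp
  also have "\<dots> \<le> (\<integral>\<^sup>+ x. (ennreal (cmod (f x)))\<^sup>2 \<partial>lborel) * (\<integral>\<^sup>+ x. (ennreal (cmod (g x)))\<^sup>2 \<partial>lborel)"
    by (rule Cauchy_Schwarz_nn_integral) measurable
  finally show ?thesis
    by (simp add: sqnorm_def ennreal_power)
qed

lemma L2_Cauchy_Schwarz_inner:
  assumes "f \<in> L2" "g \<in> L2"
  shows "ennreal ((cmod (L2_inner f g))\<^sup>2) \<le> sqnorm f * sqnorm g"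
  using L2_Cauchy_Schwarz[OF assms(1) L2_cnj[OF assms(2)]]
  by (simp add: L2_inner_def sqnorm_def)

lemma sqnorm_eq_0_AE:
  assumes [measurable]: "f \<in> borel_measurable borel" and "sqnorm f = 0"
  shows "AE x in lborel. f x = 0"
  using assms(2) unfolding sqnorm_def by (subst (asm) nn_integral_0_iff_AE) auto

text \<open>Tested with the conjugate of \<open>f - g\<close>, the hypothesis makes the squared norm
  of \<open>f - g\<close> vanish.\<close>

lemma L2_eq_AE_if_integral_mult_eq:
  assumes "f \<in> L2" "g \<in> L2"
    and eq: "\<And>v. v \<in> L2 \<Longrightarrow> (LBINT x. v x * f x) = (LBINT x. v x * g x)"
  shows "AE x in lborel. f x = g x"
proof -
  define u where "u = (\<lambda>x. f x - g x)"
  have u: "u \<in> L2"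
    unfolding u_def using assms by (intro L2_diff)
  note [measurable] = u[THEN L2_measurable]
  have "(LBINT x. cnj (u x) * u x) = (LBINT x. cnj (u x) * f x - cnj (u x) * g x)"
    by (simp add: u_def algebra_simps)
  also have "\<dots> = 0"
    using eq[OF L2_cnj[OF u]] assms u
    by (subst Bochner_Integration.integral_diff) (auto intro!: L2_integrable_mult L2_cnj)
  finally have "(LBINT x. complex_of_real ((cmod (u x))\<^sup>2)) = 0"
    by (simp only: complex_norm_square) (simp add: mult.commute)
  then have "(LBINT x. (cmod (u x))\<^sup>2) = 0"
    unfolding integral_complex_of_real by simp
  then have "sqnorm u = 0"
    using sqnorm_eq_integral[OF u] by simp
  from sqnorm_eq_0_AE[OF L2_measurable[OF u] this] show ?thesis
    by (simp add: u_def)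
qed

lemma L2_tendsto_integral_mult:
  assumes f: "f \<in> L2" "\<And>n. F n \<in> L2" "(\<lambda>n. sqnorm (\<lambda>x. F n x - f x)) \<longlonglongrightarrow> 0"
    and g: "g \<in> L2"
  shows "(\<lambda>n. LBINT x. F n x * g x) \<longlonglongrightarrow> (LBINT x. f x * g x)"
proof -
  have "(\<lambda>n. sqnorm (\<lambda>x. F n x - f x) * sqnorm g) \<longlonglongrightarrow> 0 * sqnorm g"
    using L2_sqnorm_finite[OF g] by (intro tendsto_mult_ennreal f tendsto_const) auto
  then have "(\<lambda>n. sqnorm (\<lambda>x. F n x - f x) * sqnorm g) \<longlonglongrightarrow> 0"
    by simp
  then have "(\<lambda>n. ennreal ((cmod (LBINT x. (F n x - f x) * g x))\<^sup>2)) \<longlonglongrightarrow> 0"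
    by (rule tendsto_sandwich[OF _ _ tendsto_const, rotated 2])
       (auto intro!: always_eventually L2_Cauchy_Schwarz L2_diff f g)
  then have "(\<lambda>n. (cmod (LBINT x. (F n x - f x) * g x))\<^sup>2) \<longlonglongrightarrow> 0"
    by (subst (asm) tendsto_ennreal_iff[of _ _ 0, simplified]) auto
  then have "(\<lambda>n. sqrt ((cmod (LBINT x. (F n x - f x) * g x))\<^sup>2)) \<longlonglongrightarrow> sqrt 0"
    by (rule tendsto_real_sqrt)
  then have "(\<lambda>n. LBINT x. (F n x - f x) * g x) \<longlonglongrightarrow> 0"
    by (simp add: tendsto_norm_zero_iff)
  moreover have "(LBINT x. (F n x - f x) * g x) = (LBINT x. F n x * g x) - (LBINT x. f x * g x)" for n
    using f g by (simp add: left_diff_distrib L2_integrable_mult)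
  ultimately show ?thesis
    by (simp add: LIM_zero_iff)
qed

text \<open>The product splits as \<open>(F - f) * (G - g) + F * g + G * f - f * g\<close>. The
  first term vanishes by Cauchy-Schwarz and the others have at most one moving factor, which avoids
  uniform bounds on the sequences.\<close>

lemma L2_tendsto_integral_mult_both:
  assumes f: "f \<in> L2" "\<And>n. F n \<in> L2" "(\<lambda>n. sqnorm (\<lambda>x. F n x - f x)) \<longlonglongrightarrow> 0"
    and g: "g \<in> L2" "\<And>n. G n \<in> L2" "(\<lambda>n. sqnorm (\<lambda>x. G n x - g x)) \<longlonglongrightarrow> 0"
  shows "(\<lambda>n. LBINT x. F n x * G n x) \<longlonglongrightarrow> (LBINT x. f x * g x)"
proof -
  have "(\<lambda>n. sqnorm (\<lambda>x. F n x - f x) * sqnorm (\<lambda>x. G n x - g x)) \<longlonglongrightarrow> 0 * 0"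
    by (intro tendsto_mult_ennreal f g) auto
  then have "(\<lambda>n. sqnorm (\<lambda>x. F n x - f x) * sqnorm (\<lambda>x. G n x - g x)) \<longlonglongrightarrow> 0"
    by simp
  then have "(\<lambda>n. ennreal ((cmod (LBINT x. (F n x - f x) * (G n x - g x)))\<^sup>2)) \<longlonglongrightarrow> 0"
    by (rule tendsto_sandwich[OF _ _ tendsto_const, rotated 2])
       (auto intro!: always_eventually L2_Cauchy_Schwarz L2_diff f g)
  then have "(\<lambda>n. (cmod (LBINT x. (F n x - f x) * (G n x - g x)))\<^sup>2) \<longlonglongrightarrow> 0"
    by (subst (asm) tendsto_ennreal_iff[of _ _ 0, simplified]) auto
  then have "(\<lambda>n. sqrt ((cmod (LBINT x. (F n x - f x) * (G n x - g x)))\<^sup>2)) \<longlonglongrightarrow> sqrt 0"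
    by (rule tendsto_real_sqrt)
  then have 1: "(\<lambda>n. LBINT x. (F n x - f x) * (G n x - g x)) \<longlonglongrightarrow> 0"
    by (simp add: tendsto_norm_zero_iff)
  have 2: "(\<lambda>n. LBINT x. F n x * g x) \<longlonglongrightarrow> (LBINT x. f x * g x)"
    by (intro L2_tendsto_integral_mult f g)
  have 3: "(\<lambda>n. LBINT x. G n x * f x) \<longlonglongrightarrow> (LBINT x. g x * f x)"
    by (intro L2_tendsto_integral_mult f g)
  have *: "(LBINT x. (F n x - f x) * (G n x - g x)) + (LBINT x. F n x * g x) + (LBINT x. G n x * f x)
      - (LBINT x. f x * g x) = (LBINT x. F n x * G n x)" for n
  proof -
    have i: "integrable lborel (\<lambda>x. F n x * G n x)" "integrable lborel (\<lambda>x. F n x * g x)"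
      "integrable lborel (\<lambda>x. G n x * f x)" "integrable lborel (\<lambda>x. f x * g x)"
      using f g by (auto intro!: L2_integrable_mult)
    have "(LBINT x. (F n x - f x) * (G n x - g x))
        = (LBINT x. F n x * G n x - F n x * g x - G n x * f x + f x * g x)"
      by (simp add: algebra_simps)
    also have "\<dots> = (LBINT x. F n x * G n x) - (LBINT x. F n x * g x) - (LBINT x. G n x * f x)
        + (LBINT x. f x * g x)"
      using i by simp
    finally show ?thesis by simp
  qed
  have "(\<lambda>n. (LBINT x. (F n x - f x) * (G n x - g x)) + (LBINT x. F n x * g x) + (LBINT x. G n x * f x)
      - (LBINT x. f x * g x)) \<longlonglongrightarrow> 0 + (LBINT x. f x * g x) + (LBINT x. g x * f x) - (LBINT x. f x * g x)"
    by (intro tendsto_intros 1 2 3)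
  then show ?thesis
    unfolding * by (simp add: mult.commute)
qed

text \<open>A subsequence with summable weighted increments converges almost everywhere, and Fatou's
  lemma identifies its limit as the \<open>L\<^sup>2\<close> limit.\<close>

lemma L2_complete:
  fixes u :: "nat \<Rightarrow> 'a::euclidean_space \<Rightarrow> complex"
  assumes u: "\<And>n. u n \<in> L2"
    and bound: "\<And>m n. n \<le> m \<Longrightarrow> sqnorm (\<lambda>x. u m x - u n x) \<le> e n"
    and e: "e \<longlonglongrightarrow> 0"
  shows "\<exists>g\<in>L2. (\<lambda>n. sqnorm (\<lambda>x. u n x - g x)) \<longlonglongrightarrow> 0"
proof -
  note [measurable] = u[THEN L2_measurable]
  have "\<exists>N. e N \<le> ennreal ((1/8) ^ k) \<and> k \<le> N" for k
  proof -
    have "eventually (\<lambda>n. e n < ennreal ((1/8) ^ k)) sequentially"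
      by (rule order_tendstoD(2)[OF e]) simp
    then have "eventually (\<lambda>n. e n < ennreal ((1/8) ^ k) \<and> k \<le> n) sequentially"
      by (intro eventually_conj eventually_ge_at_top)
    then show ?thesis
      by (auto simp: eventually_sequentially intro: less_imp_le)
  qed
  then obtain p where p: "\<And>k. e (p k) \<le> ennreal ((1/8) ^ k)" "\<And>k. k \<le> p k"
    by metis
  \<comment> \<open>A running maximum of \<open>p\<close>: nondecreasing and still beyond
    \<open>p k\<close>, so that \<open>e (p k)\<close> controls the k-th increment.\<close>
  define r where "r = rec_nat (p 0) (\<lambda>k m. max m (p (Suc k)))"
  have r_Suc: "r (Suc k) = max (r k) (p (Suc k))" and r_0: "r 0 = p 0" for k
    by (simp_all add: r_def)
  have r_p: "p k \<le> r k" for k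
    by (cases k) (simp_all add: r_0 r_Suc)
  have r_mono: "r k \<le> r (Suc k)" for k
    by (simp add: r_Suc)
  have r_top: "filterlim r at_top sequentially"
    by (rule filterlim_at_top_mono[OF filterlim_ident])
       (auto intro!: always_eventually order_trans[OF p(2) r_p])
  define d where "d k x = u (r (Suc k)) x - u (r k) x" for k x
  have [measurable]: "d k \<in> borel_measurable borel" for k
    unfolding d_def by measurable
  \<comment> \<open>\<open>bound\<close> compares a later term with an earlier one, so both ends of
    the increment are measured from the common index \<open>p k\<close>; the factor 4 comes from the
    squared triangle inequality.\<close>
  have sqnorm_d: "sqnorm (d k) \<le> ennreal (4 * (1/8) ^ k)" for k
  proof -
    have "sqnorm (d k) = sqnorm (\<lambda>x. (u (r (Suc k)) x - u (p k) x) - (u (r k) x - u (p k) x))"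
      by (simp add: d_def[abs_def])
    also have "\<dots> \<le> 2 * sqnorm (\<lambda>x. u (r (Suc k)) x - u (p k) x) + 2 * sqnorm (\<lambda>x. u (r k) x - u (p k) x)"
      by (rule sqnorm_diff_le) measurable
    also have "\<dots> \<le> 2 * e (p k) + 2 * e (p k)"
      using r_p[of k] r_mono[of k] by (intro add_mono mult_left_mono bound) auto
    also have "\<dots> = 4 * e (p k)"
      by (simp flip: distrib_right)
    also have "\<dots> \<le> 4 * ennreal ((1/8) ^ k)"
      by (intro mult_left_mono p) auto
    finally show ?thesis
      by (simp add: ennreal_mult)
  qed
  \<comment> \<open>Weights 4^k against increments of order 8^(-k) leave a geometric series.
    Conversely, bounded weighted terms force \<open>cmod (d k x)\<close> to decay like 2^(-k), hence
    summably.\<close>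
  have "(\<integral>\<^sup>+ x. (\<Sum>k. ennreal (4 ^ k * (cmod (d k x))\<^sup>2)) \<partial>lborel) = (\<Sum>k. ennreal (4 ^ k) * sqnorm (d k))"
    unfolding sqnorm_def by (subst nn_integral_suminf) (auto simp: ennreal_mult nn_integral_cmult)
  also have "\<dots> \<le> (\<Sum>k. ennreal (4 * (1/2) ^ k))"
  proof (intro suminf_le)
    fix k
    have "ennreal (4 ^ k) * sqnorm (d k) \<le> ennreal (4 ^ k) * ennreal (4 * (1/8) ^ k)"
      by (intro mult_left_mono sqnorm_d) auto
    also have "\<dots> = ennreal (4 * (1/2) ^ k)"
      by (subst ennreal_mult[symmetric]) (auto simp: mult.left_commute simp flip: power_mult_distrib)
    finally show "ennreal (4 ^ k) * sqnorm (d k) \<le> ennreal (4 * (1/2) ^ k)" .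
  qed auto
  also have "\<dots> = ennreal (\<Sum>k. 4 * (1/2) ^ k)"
    by (intro suminf_ennreal2) (auto intro!: summable_mult summable_geometric)
  also have "\<dots> < \<infinity>" by simp
  finally have "AE x in lborel. (\<Sum>k. ennreal (4 ^ k * (cmod (d k x))\<^sup>2)) \<noteq> \<infinity>"
    by (intro nn_integral_PInf_AE) auto
  then have conv: "AE x in lborel. convergent (\<lambda>k. u (r k) x)"
  proof eventually_elim
    case (elim x)
    have s: "summable (\<lambda>k. 4 ^ k * (cmod (d k x))\<^sup>2)"
      by (rule summable_suminf_not_top) (use elim in auto)
    then have "Bseq (\<lambda>k. 4 ^ k * (cmod (d k x))\<^sup>2)"
      by (intro convergent_imp_Bseq) (auto simp: convergent_def intro: summable_LIMSEQ_zero)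
    then obtain B where B: "B > 0" "\<And>k. 4 ^ k * (cmod (d k x))\<^sup>2 \<le> B"
      by (auto simp: Bseq_def)
    have "cmod (d k x) \<le> sqrt B * (1/2) ^ k" for k
    proof -
      have "(2 ^ k * cmod (d k x))\<^sup>2 \<le> (sqrt B)\<^sup>2"
        using B(2)[of k] B(1) by (simp add: power_mult_distrib power_mult[symmetric] mult.commute[of _ 2])
           (simp add: power_mult)
      then have "2 ^ k * cmod (d k x) \<le> sqrt B"
        by (rule power2_le_imp_le) (use B in auto)
      then show ?thesis
        by (simp add: field_simps power_divide)
    qed
    then have le: "norm (d k x) \<le> sqrt B * (1/2) ^ k" for k
      by simp
    have "summable (\<lambda>k. d k x)"
      by (rule summable_comparison_test'[OF _ le]) (simp add: summable_mult summable_geometric)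
    then have "convergent (\<lambda>n. \<Sum>k<n. d k x)"
      by (simp add: summable_iff_convergent)
    moreover have "(\<Sum>k<n. d k x) = u (r n) x - u (r 0) x" for n
      unfolding d_def by (rule sum_lessThan_telescope)
    ultimately have "convergent (\<lambda>n. u (r n) x - u (r 0) x)"
      by simp
    then have "convergent (\<lambda>n. (u (r n) x - u (r 0) x) + u (r 0) x)"
      by (intro convergent_add convergent_const)
    then show ?case by simp
  qed
  \<comment> \<open>\<open>lim\<close> has some value even where the sequence diverges, so
    \<open>g\<close> is defined and measurable everywhere; divergence is confined to a null
    set.\<close>
  define g where "g x = lim (\<lambda>k. u (r k) x)" for x
  have [measurable]: "g \<in> borel_measurable borel"
    unfolding g_def by measurable
  have lim: "AE x in lborel. (\<lambda>k. u (r k) x) \<longlonglongrightarrow> g x"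
    using conv by eventually_elim (simp add: g_def convergent_LIMSEQ_iff)
  \<comment> \<open>Fatou is applied along the subsequence with \<open>n\<close> fixed, so the whole
    sequence converges, at the rate \<open>e n\<close>.\<close>
  have g_bound: "sqnorm (\<lambda>x. u n x - g x) \<le> e n" for n
  proof -
    have "sqnorm (\<lambda>x. u n x - g x) = (\<integral>\<^sup>+ x. liminf (\<lambda>k. ennreal ((cmod (u n x - u (r k) x))\<^sup>2)) \<partial>lborel)"
      unfolding sqnorm_def
    proof (rule nn_integral_cong_AE, use lim in eventually_elim)
      case (elim x)
      have "(\<lambda>k. ennreal ((cmod (u n x - u (r k) x))\<^sup>2)) \<longlonglongrightarrow> ennreal ((cmod (u n x - g x))\<^sup>2)"
        by (intro tendsto_intros elim)
      from lim_imp_Liminf[OF _ this] show ?case by simp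
    qed
    also have "\<dots> \<le> liminf (\<lambda>k. sqnorm (\<lambda>x. u n x - u (r k) x))"
      unfolding sqnorm_def by (rule nn_integral_liminf) measurable
    also have "\<dots> \<le> e n"
    proof -
      have "eventually (\<lambda>k. n \<le> r k) sequentially"
        using r_top by (auto simp: filterlim_at_top)
      then have "eventually (\<lambda>k. sqnorm (\<lambda>x. u n x - u (r k) x) \<le> e n) sequentially"
        by eventually_elim (use sqnorm_minus_commute bound in metis)
      then have "liminf (\<lambda>k. sqnorm (\<lambda>x. u n x - u (r k) x)) \<le> liminf (\<lambda>k::nat. e n)"
        by (rule Liminf_mono)
      then show ?thesis
        by (simp add: Liminf_const)
    qed
    finally show ?thesis .
  qed
  have "(\<lambda>n. sqnorm (\<lambda>x. u n x - g x)) \<longlonglongrightarrow> 0"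
    by (rule tendsto_sandwich[OF _ _ tendsto_const e]) (auto intro!: always_eventually g_bound)
  moreover have "g \<in> L2"
  proof -
    \<comment> \<open>\<open>e\<close> may be infinite at first; one index with a finite bound
      already puts the limit in L2.\<close>
    have "eventually (\<lambda>n. e n < 1) sequentially"
      by (rule order_tendstoD(2)[OF e]) simp
    then obtain n where "e n < 1"
      by (auto simp: eventually_sequentially)
    then have "sqnorm (\<lambda>x. u n x - g x) < \<infinity>"
      using g_bound[of n] by (auto intro: le_less_trans less_trans)
    then have "(\<lambda>x. u n x - g x) \<in> L2"
      by (intro L2I_sqnorm) auto
    from L2_diff[OF u[of n] this] show ?thesis
      by simp
  qed
  ultimately show ?thesis by blast
qed

section \<open>Gaussian averages\<close>

lemma
  fixes f :: "'a::euclidean_space \<Rightarrow> real \<Rightarrow> 'b::{real_normed_field, banach, second_countable_topology}"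
  assumes f: "\<And>b. b \<in> Basis \<Longrightarrow> integrable lborel (f b)"
  shows integrable_lborel_prod: "integrable lborel (\<lambda>x::'a. \<Prod>b\<in>Basis. f b (x \<bullet> b))" (is ?A)
    and integral_lborel_prod: "(LBINT x. (\<Prod>b\<in>Basis. f b (x \<bullet> b))) = (\<Prod>b\<in>Basis. LBINT x. f b x)" (is ?B)
proof -
  interpret product_sigma_finite "\<lambda>_::'a. lborel :: real measure" ..
  have [measurable]: "f b \<in> borel_measurable borel" if "b \<in> Basis" for b
    using borel_measurable_integrable[OF f[OF that]] by simp
  have [measurable]: "(\<lambda>x::'a. \<Prod>b\<in>Basis. f b (x \<bullet> b)) \<in> borel_measurable borel"
    by measurable
  have [measurable]: "(\<lambda>g. \<Sum>b\<in>Basis. g b *\<^sub>R b) \<in> measurable (\<Pi>\<^sub>M b\<in>(Basis::'a set). lborel) borel"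
    by measurable
  have eq: "(\<Prod>b\<in>Basis. f b ((\<Sum>c\<in>Basis. g c *\<^sub>R c) \<bullet> b)) = (\<Prod>b\<in>Basis. f b (g b))" for g :: "'a \<Rightarrow> real"
    by (intro prod.cong) simp_all
  \<comment> \<open>\<open>lborel_eq\<close> writes Lebesgue measure as the image of a product of
    one-dimensional ones under the coordinate map, so both claims become Fubini over the
    basis.\<close>
  show ?A
    by (subst lborel_eq, subst integrable_distr_eq)
       (auto simp: eq intro!: product_integrable_prod f)
  show ?B
    by (subst lborel_eq, subst integral_distr)
       (auto simp: eq intro!: product_integral_prod f)
qed

lemma nn_integral_lborel_affine:
  fixes t :: "'a::euclidean_space"
  assumes [measurable]: "f \<in> borel_measurable borel" and "c \<noteq> 0"
  shows "(\<integral>\<^sup>+x. f x \<partial>lborel) = ennreal (\<bar>c\<bar> ^ DIM('a)) * (\<integral>\<^sup>+x. f (t + c *\<^sub>R x) \<partial>lborel)"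
  by (subst lborel_affine[OF assms(2), of t])
     (simp add: nn_integral_density nn_integral_distr nn_integral_cmult)

lemma nn_integral_lborel_translate:
  fixes t :: "'a::euclidean_space"
  assumes "f \<in> borel_measurable borel"
  shows "(\<integral>\<^sup>+x. f (x + t) \<partial>lborel) = (\<integral>\<^sup>+x. f x \<partial>lborel)"
  using nn_integral_lborel_affine[OF assms, of 1 t] by (simp add: add.commute)

lemma integrable_lborel_affine:
  fixes f :: "'a::euclidean_space \<Rightarrow> 'b::{banach, second_countable_topology}"
  assumes f: "integrable lborel f" and "c \<noteq> 0"
  shows "integrable lborel (\<lambda>x. f (t + c *\<^sub>R x))"
  using f f[THEN borel_measurable_integrable] \<open>c \<noteq> 0\<close> unfolding integrable_iff_bounded
  by (subst (asm) nn_integral_lborel_affine[where c=c and t=t]) (auto simp: ennreal_mult_less_top)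

lemma integral_lborel_affine:
  fixes f :: "'a::euclidean_space \<Rightarrow> 'b::{banach, second_countable_topology}"
  assumes f: "integrable lborel f" and c: "c \<noteq> 0"
  shows "(LBINT x. f x) = (\<bar>c\<bar> ^ DIM('a)) *\<^sub>R (LBINT x. f (t + c *\<^sub>R x))"
  using c f f[THEN borel_measurable_integrable] integrable_lborel_affine[OF f c, of t]
  by (subst lborel_affine[OF c, of t]) (simp add: integral_density integral_distr)

text \<open>The standard normal density of the space, as a product so that its mass and its Fourier
  transform reduce to the one-dimensional distribution.\<close>

definition gauss :: "'a::euclidean_space \<Rightarrow> real" where
  "gauss z = (\<Prod>b\<in>Basis. std_normal_density (z \<bullet> b))"

lemma borel_measurable_gauss [measurable]: "gauss \<in> borel_measurable borel"
  unfolding gauss_def by measurable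

lemma norm_square_eq_sum:
  "(norm (x::'a::euclidean_space))\<^sup>2 = (\<Sum>b\<in>Basis. (x \<bullet> b)\<^sup>2)"
  unfolding power2_norm_eq_inner by (subst euclidean_inner) (simp add: power2_eq_square)

lemma gauss_eq:
  "gauss (z::'a::euclidean_space) = (2 * pi) powr (- real DIM('a) / 2) * exp (- (norm z)\<^sup>2 / 2)"
proof -
  have "gauss z = (1 / sqrt (2 * pi)) ^ DIM('a) * exp (\<Sum>b\<in>Basis. - (z \<bullet> b)\<^sup>2 / 2)"
    unfolding gauss_def std_normal_density_def by (simp only: prod.distrib prod_constant exp_sum finite_Basis)
  also have "(\<Sum>b\<in>Basis. - (z \<bullet> b)\<^sup>2 / 2) = - (norm z)\<^sup>2 / 2"
    by (simp add: norm_square_eq_sum flip: sum_divide_distrib)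
       (simp add: sum_negf sum_divide_distrib)
  also have "(1 / sqrt (2 * pi)) ^ DIM('a) = (2 * pi) powr (- real DIM('a) / 2)"
    by (simp add: powr_half_sqrt[symmetric] powr_minus_divide power_one_over powr_realpow[symmetric] powr_powr
        powr_minus mult.commute)
  finally show ?thesis .
qed

lemma gauss_nonneg [simp]: "0 \<le> gauss z"
  unfolding gauss_def by (intro prod_nonneg) auto

lemma gauss_le_1: "gauss z \<le> 1"
proof -
  have "std_normal_density x \<le> 1" for x
  proof -
    have "sqrt (2 * pi) \<ge> 1"
      using pi_gt3 by simp
    then have "1 / sqrt (2 * pi) * exp (- x\<^sup>2 / 2) \<le> 1 * 1"
      by (intro mult_mono) (auto simp: field_simps)
    then show ?thesis by (simp add: std_normal_density_def)
  qed
  then show ?thesis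
    unfolding gauss_def by (intro prod_le_1) auto
qed

lemma integrable_gauss: "integrable lborel gauss"
  unfolding gauss_def[abs_def] by (rule integrable_lborel_prod) simp

lemma integral_gauss: "(LBINT z. gauss z) = 1"
  unfolding gauss_def[abs_def] by (subst integral_lborel_prod) auto

lemma nn_integral_gauss: "(\<integral>\<^sup>+z. ennreal (gauss z) \<partial>lborel) = 1"
  using integrable_gauss integral_gauss by (subst nn_integral_eq_integral) auto

lemma gauss_char:
  fixes \<zeta> :: "'a::euclidean_space"
  shows "(LBINT z. complex_of_real (gauss z) * exp (- (\<i> * complex_of_real (z \<bullet> \<zeta>))))
    = complex_of_real (exp (- (norm \<zeta>)\<^sup>2 / 2))"
proof -
  \<comment> \<open>The argument is negated because the Fourier kernel has the exponent -i, whereas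
    \<open>char\<close> uses +i.\<close>
  define f where "f b x = std_normal_density x *\<^sub>R iexp (- (\<zeta> \<bullet> b) * x)" for b :: 'a and x :: real
  have int: "integrable lborel (f b)" for b
    unfolding f_def
    by (rule Bochner_Integration.integrable_bound[where f=std_normal_density]) auto
  have val: "(LBINT x. f b x) = complex_of_real (exp (- (\<zeta> \<bullet> b)\<^sup>2 / 2))" for b
  proof -
    have "(LBINT x. f b x) = char std_normal_distribution (- (\<zeta> \<bullet> b))"
      unfolding char_def f_def by (subst integral_density) auto
    then show ?thesis
      by (simp add: char_std_normal_distribution)
  qed
  have "complex_of_real (gauss z) * exp (- (\<i> * complex_of_real (z \<bullet> \<zeta>))) = (\<Prod>b\<in>Basis. f b (z \<bullet> b))" for z
  proof -
    have "- (\<i> * complex_of_real (z \<bullet> \<zeta>)) = (\<Sum>b\<in>Basis. \<i> * complex_of_real (- (\<zeta> \<bullet> b) * (z \<bullet> b)))"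
      by (subst euclidean_inner) (simp add: sum_distrib_left sum_negf mult.commute)
    then show ?thesis
      by (simp add: gauss_def f_def scaleR_conv_of_real prod.distrib exp_sum)
  qed
  then have "(LBINT z. complex_of_real (gauss z) * exp (- (\<i> * complex_of_real (z \<bullet> \<zeta>))))
      = (\<Prod>b\<in>Basis. complex_of_real (exp (- (\<zeta> \<bullet> b)\<^sup>2 / 2)))"
    by (simp add: integral_lborel_prod[OF int] val)
  also have "\<dots> = complex_of_real (exp (\<Sum>b\<in>Basis. - (\<zeta> \<bullet> b)\<^sup>2 / 2))"
    by (simp add: exp_sum)
  also have "(\<Sum>b\<in>Basis. - (\<zeta> \<bullet> b)\<^sup>2 / 2) = - (norm \<zeta>)\<^sup>2 / 2"
    by (simp add: norm_square_eq_sum flip: sum_divide_distrib)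
       (simp add: sum_negf sum_divide_distrib)
  finally show ?thesis .
qed

text \<open>Convolution with the Gaussian of width \<open>a\<close>, written after rescaling: the
  density stays fixed and \<open>a\<close> only moves the argument of \<open>k\<close>, which suits
  dominated convergence as \<open>a\<close> tends to 0.\<close>

definition gauss_smooth :: "real \<Rightarrow> ('a::euclidean_space \<Rightarrow> complex) \<Rightarrow> 'a \<Rightarrow> complex" where
  "gauss_smooth a k x = (LBINT z. complex_of_real (gauss z) * k (x + a *\<^sub>R z))"

lemma borel_measurable_gauss_smooth [measurable]:
  assumes [measurable]: "k \<in> borel_measurable borel"
  shows "gauss_smooth a k \<in> borel_measurable borel"
  unfolding gauss_smooth_def[abs_def] by measurable

lemma integrable_gauss_smooth:
  assumes k: "k \<in> L2" and a: "a \<noteq> 0"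
  shows "integrable lborel (\<lambda>z. complex_of_real (gauss z) * k (x + a *\<^sub>R z))"
proof (rule Bochner_Integration.integrable_bound)
  note [measurable] = k[THEN L2_measurable]
  show "integrable lborel (\<lambda>z. gauss z + (cmod (k (x + a *\<^sub>R z)))\<^sup>2)"
    using k integrable_lborel_affine[of "\<lambda>x. (cmod (k x))\<^sup>2" a x] a
    by (auto intro!: Bochner_Integration.integrable_add integrable_gauss simp: L2_def)
  show "(\<lambda>z. complex_of_real (gauss z) * k (x + a *\<^sub>R z)) \<in> borel_measurable lborel"
    by measurable
  \<comment> \<open>A dominating function from a Gaussian that is bounded by 1 and a square
    integrable factor: the first summand suffices for \<open>y \<le> 1\<close>, the second
    otherwise.\<close>
  have "g * y \<le> g + y\<^sup>2" if "0 \<le> g" "g \<le> 1" "0 \<le> y" for g y :: real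
  proof (cases "y \<le> 1")
    case True
    then have "g * y \<le> g * 1"
      using that by (intro mult_left_mono) auto
    then show ?thesis by (simp add: add_increasing2)
  next
    case False
    then have "g * y \<le> y * y"
      using that by (intro mult_right_mono) auto
    then show ?thesis
      using that by (simp add: power2_eq_square)
  qed
  then show "AE z in lborel. norm (complex_of_real (gauss z) * k (x + a *\<^sub>R z))
      \<le> norm (gauss z + (cmod (k (x + a *\<^sub>R z)))\<^sup>2)"
    by (auto simp: norm_mult gauss_le_1)
qed

lemma gauss_smooth_diff:
  assumes "k \<in> L2" "l \<in> L2" "a \<noteq> 0"
  shows "gauss_smooth a (\<lambda>x. k x - l x) = (\<lambda>x. gauss_smooth a k x - gauss_smooth a l x)"
  unfolding gauss_smooth_def[abs_def] using integrable_gauss_smooth[OF assms(1,3)] integrable_gauss_smooth[OF assms(2,3)]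
  by (simp add: right_diff_distrib)

text \<open>Jensen's inequality for a probability density: Cauchy-Schwarz with \<open>gauss\<close>
  split into two square roots bounds the square of the average by the average of the squares;
  Tonelli and translation invariance do the rest.\<close>

lemma sqnorm_gauss_smooth_le:
  fixes k :: "'a::euclidean_space \<Rightarrow> complex"
  assumes k: "k \<in> L2" and a: "a \<noteq> 0"
  shows "sqnorm (gauss_smooth a k) \<le> sqnorm k"
proof -
  note [measurable] = k[THEN L2_measurable]
  interpret lborel_pair: pair_sigma_finite "lborel :: 'a measure" "lborel :: 'a measure" ..
  have "sqnorm (gauss_smooth a k) \<le> (\<integral>\<^sup>+x. \<integral>\<^sup>+z. ennreal (gauss z) * ennreal ((cmod (k (x + a *\<^sub>R z)))\<^sup>2) \<partial>lborel \<partial>lborel)"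
    unfolding sqnorm_def
  proof (rule nn_integral_mono)
    fix x
    let ?g = "\<lambda>z::'a. ennreal (sqrt (gauss z))" and ?h = "\<lambda>z. ennreal (sqrt (gauss z) * cmod (k (x + a *\<^sub>R z)))"
    have "ennreal (cmod (gauss_smooth a k x)) \<le> (\<integral>\<^sup>+z. ?g z * ?h z \<partial>lborel)"
      using integral_norm_bound_ennreal[OF integrable_gauss_smooth[OF k a, of x]]
      by (simp add: gauss_smooth_def norm_mult flip: ennreal_mult mult.assoc)
    then have "ennreal ((cmod (gauss_smooth a k x))\<^sup>2) \<le> (\<integral>\<^sup>+z. ?g z * ?h z \<partial>lborel)\<^sup>2"
      by (simp add: power_mono flip: ennreal_power)
    also have "\<dots> \<le> (\<integral>\<^sup>+z. (?g z)\<^sup>2 \<partial>lborel) * (\<integral>\<^sup>+z. (?h z)\<^sup>2 \<partial>lborel)"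
      by (rule Cauchy_Schwarz_nn_integral) measurable
    also have "(\<integral>\<^sup>+z. (?g z)\<^sup>2 \<partial>lborel) = 1"
      using nn_integral_gauss by (simp add: ennreal_power)
    also have "(\<integral>\<^sup>+z. (?h z)\<^sup>2 \<partial>lborel) = (\<integral>\<^sup>+z. ennreal (gauss z) * ennreal ((cmod (k (x + a *\<^sub>R z)))\<^sup>2) \<partial>lborel)"
      by (simp add: ennreal_power power_mult_distrib flip: ennreal_mult)
    finally show "ennreal ((cmod (gauss_smooth a k x))\<^sup>2)
      \<le> (\<integral>\<^sup>+z. ennreal (gauss z) * ennreal ((cmod (k (x + a *\<^sub>R z)))\<^sup>2) \<partial>lborel)" by simp
  qed
  also have "\<dots> = (\<integral>\<^sup>+z. \<integral>\<^sup>+x. ennreal (gauss z) * ennreal ((cmod (k (x + a *\<^sub>R z)))\<^sup>2) \<partial>lborel \<partial>lborel)"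
    by (rule lborel_pair.Fubini') measurable
  also have "\<dots> = (\<integral>\<^sup>+z. ennreal (gauss (z::'a)) * sqnorm k \<partial>lborel)"
    unfolding sqnorm_def
    by (simp add: nn_integral_cmult nn_integral_lborel_translate[of "\<lambda>x. ennreal ((cmod (k x))\<^sup>2)"])
  also have "\<dots> = sqnorm k"
    by (simp add: nn_integral_multc nn_integral_gauss)
  finally show ?thesis .
qed

lemma L2_gauss_smooth: "k \<in> L2 \<Longrightarrow> a \<noteq> 0 \<Longrightarrow> gauss_smooth a k \<in> L2"
  by (rule L2I_sqnorm[OF borel_measurable_gauss_smooth le_less_trans[OF sqnorm_gauss_smooth_le L2_sqnorm_finite]])
     (simp_all add: L2_measurable)

section \<open>Density of bounded continuous functions in L2\<close>

lemma tendsto_sqnorm_dominated: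
  assumes [measurable]: "\<And>n. f n \<in> borel_measurable borel" "g \<in> borel_measurable borel"
    and w: "w \<in> L2" and bound: "\<And>n x. cmod (f n x - g x) \<le> cmod (w x)"
    and lim: "AE x in lborel. (\<lambda>n. f n x) \<longlonglongrightarrow> g x"
  shows "(\<lambda>n. sqnorm (\<lambda>x. f n x - g x)) \<longlonglongrightarrow> 0"
proof -
  note [measurable] = w[THEN L2_measurable]
  have "(\<lambda>n. sqnorm (\<lambda>x. f n x - g x)) \<longlonglongrightarrow> (\<integral>\<^sup>+x. 0 \<partial>(lborel :: 'a measure))"
    unfolding sqnorm_def
  proof (rule nn_integral_dominated_convergence[where w="\<lambda>x. ennreal ((cmod (w x))\<^sup>2)"])
    show "AE x in lborel. (\<lambda>n. ennreal ((cmod (f n x - g x))\<^sup>2)) \<longlonglongrightarrow> 0"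
      using lim
    proof eventually_elim
      case (elim x)
      have "(\<lambda>n. ennreal ((cmod (f n x - g x))\<^sup>2)) \<longlonglongrightarrow> ennreal ((cmod (g x - g x))\<^sup>2)"
        by (intro tendsto_intros elim)
      then show ?case by simp
    qed
    show "(\<integral>\<^sup>+ x. ennreal ((cmod (w x))\<^sup>2) \<partial>lborel) < \<infinity>"
      using L2_sqnorm_finite[OF w] by (simp add: sqnorm_def)
  qed (auto intro!: AE_I2 ennreal_leI power_mono bound)
  then show ?thesis by simp
qed

lemma L2_truncate_tendsto:
  assumes k: "k \<in> L2"
  shows "(\<lambda>n. sqnorm (\<lambda>x. (if norm x \<le> real n \<and> cmod (k x) \<le> real n then k x else 0) - k x)) \<longlonglongrightarrow> 0"
proof (rule tendsto_sqnorm_dominated[OF _ _ k])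
  note [measurable] = k[THEN L2_measurable]
  show "(\<lambda>x. if norm x \<le> real n \<and> cmod (k x) \<le> real n then k x else 0) \<in> borel_measurable borel" for n
    by measurable
  show "k \<in> borel_measurable borel"
    by measurable
  show "AE x in lborel. (\<lambda>n. if norm x \<le> real n \<and> cmod (k x) \<le> real n then k x else 0) \<longlonglongrightarrow> k x"
  proof (rule AE_I2)
    fix x
    obtain N where "max (norm x) (cmod (k x)) \<le> real N"
      using real_arch_simple by blast
    then have "eventually (\<lambda>n. (if norm x \<le> real n \<and> cmod (k x) \<le> real n then k x else 0) = k x) sequentially"
      by (auto simp: eventually_sequentially intro!: exI[of _ N])
    then show "(\<lambda>n. if norm x \<le> real n \<and> cmod (k x) \<le> real n then k x else 0) \<longlonglongrightarrow> k x"
      by (rule tendsto_eventually)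
  qed
qed auto

lemma L2_bounded_compact_support:
  fixes f :: "'a::euclidean_space \<Rightarrow> complex"
  assumes [measurable]: "f \<in> borel_measurable borel"
    and "\<And>x. cmod (f x) \<le> B" "\<And>x. norm x > R \<Longrightarrow> f x = 0"
  shows "f \<in> L2"
proof -
  have "sqnorm f \<le> (\<integral>\<^sup>+x. ennreal (B\<^sup>2) * indicator (cball (0::'a) R) x \<partial>lborel)"
    unfolding sqnorm_def using assms
    by (intro nn_integral_mono) (auto simp: indicator_def intro!: ennreal_leI power_mono)
  also have "\<dots> = ennreal (B\<^sup>2) * emeasure lborel (cball (0::'a) R)"
    by (rule nn_integral_cmult_indicator) simp
  also have "\<dots> < \<infinity>"
    using emeasure_bounded_finite[OF bounded_cball, of "0::'a" R] by (simp add: ennreal_mult_less_top)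
  finally show ?thesis
    by (intro L2I_sqnorm) auto
qed

text \<open>A measurable function is an almost everywhere limit of continuous ones, but these need
  not be dominated. Clipping their values and cutting them off outside a ball preserves continuity
  and the limit, and supplies the domination.\<close>

lemma L2_approx_continuous_bounded:
  fixes k :: "'a::euclidean_space \<Rightarrow> complex"
  assumes [measurable]: "k \<in> borel_measurable borel" and M: "M > 0"
    and k: "\<And>x. cmod (k x) \<le> M" "\<And>x. norm x > M \<Longrightarrow> k x = 0" and "e > 0"
  shows "\<exists>\<phi>\<in>L2. continuous_on UNIV \<phi> \<and> bounded (range \<phi>) \<and> sqnorm (\<lambda>x. \<phi> x - k x) < e"
proof -
  have "k measurable_on UNIV"
    by (rule lebesgue_measurable_imp_measurable_on) (auto intro: measurable_completion)
  then obtain N F where NF: "negligible N" "\<And>n. continuous_on UNIV (F n)"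
      "\<And>x. x \<notin> N \<Longrightarrow> (\<lambda>n::nat. F n x) \<longlonglongrightarrow> k x"
    unfolding measurable_on_def by auto
  \<comment> \<open>The radial retraction of the complex plane onto the disc of radius
    \<open>M\<close>.\<close>
  define c where "c w = complex_of_real (M / max M (cmod w)) * w" for w
  \<comment> \<open>A continuous cutoff: 1 on the ball of radius \<open>M\<close>, where
    \<open>k\<close> lives, and 0 beyond radius \<open>M + 1\<close>.\<close>
  define cut where "cut x = complex_of_real (max 0 (min 1 (M + 1 - norm x)))" for x :: 'a
  define \<phi> where "\<phi> n x = cut x * c (F n x)" for n x
  have c_cont: "continuous_on UNIV c"
    unfolding c_def using M by (intro continuous_intros) auto
  have c_bound: "cmod (c w) \<le> M" for w
  proof -
    have "M * cmod w \<le> M * max M (cmod w)"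
      using M by (intro mult_left_mono) auto
    then show ?thesis
      using M by (simp add: c_def norm_mult norm_divide field_simps max_def split: if_splits)
  qed
  have c_id: "c w = w" if "cmod w \<le> M" for w
    using that M by (simp add: c_def max_def)
  have chi_bound: "cmod (cut x) \<le> 1" for x
    unfolding cut_def norm_of_real by (auto simp: max_def min_def)
  have phi_cont: "continuous_on UNIV (\<phi> n)" for n
    unfolding \<phi>_def cut_def
    by (intro continuous_intros continuous_on_compose2[OF c_cont NF(2)]) auto
  then have [measurable]: "\<phi> n \<in> borel_measurable borel" for n
    by (rule borel_measurable_continuous_onI)
  have phi_bound: "cmod (\<phi> n x) \<le> M" for n x
    using mult_mono[OF chi_bound[of x] c_bound[of "F n x"]] M by (simp add: \<phi>_def norm_mult)
  have phi_supp: "\<phi> n x = 0" if "norm x > M + 1" for n x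
    using that by (simp add: \<phi>_def cut_def max_def min_def)
  have phi_L2: "\<phi> n \<in> L2" for n
    by (rule L2_bounded_compact_support[of _ M "M + 1"]) (auto simp: phi_bound phi_supp)
  have "(\<lambda>n. sqnorm (\<lambda>x. \<phi> n x - k x)) \<longlonglongrightarrow> 0"
  proof (rule tendsto_sqnorm_dominated[where w="\<lambda>x. complex_of_real (2 * M * indicator (cball 0 (M + 1)) x)"])
    show "(\<lambda>x::'a. complex_of_real (2 * M * indicator (cball 0 (M + 1)) x)) \<in> L2"
      by (rule L2_bounded_compact_support[of _ "2 * M" "M + 1"]) (use M in \<open>auto simp: indicator_def\<close>)
    show "cmod (\<phi> n x - k x) \<le> cmod (complex_of_real (2 * M * indicator (cball 0 (M + 1)) x))" for n x
    proof (cases "norm x > M + 1")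
      case False
      then show ?thesis
        using norm_triangle_ineq4[of "\<phi> n x" "k x"] phi_bound[of n x] k(1)[of x] M
        by (simp add: indicator_def)
    qed (use phi_supp k M in \<open>auto simp: indicator_def\<close>)
    \<comment> \<open>\<open>N\<close> is null for the completed measure only; the statement is
      transferred to \<open>lborel\<close> afterwards.\<close>
    have "AE x in lebesgue. x \<notin> N"
      using NF(1) by (intro AE_not_in) (simp add: negligible_iff_null_sets)
    then have "AE x in lborel. x \<notin> N"
      by (simp add: AE_completion_iff)
    then show "AE x in lborel. (\<lambda>n. \<phi> n x) \<longlonglongrightarrow> k x"
    proof eventually_elim
      case (elim x)
      have "(\<lambda>n. c (F n x)) \<longlonglongrightarrow> c (k x)"
        using c_cont NF(3)[OF elim] by (auto intro: continuous_on_tendsto_compose)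
      then have "(\<lambda>n. \<phi> n x) \<longlonglongrightarrow> cut x * k x"
        unfolding \<phi>_def c_id[OF k(1)] by (intro tendsto_intros)
      moreover have "cut x * k x = k x"
        using k(2)[of x] by (cases "norm x > M") (auto simp: cut_def max_def min_def)
      ultimately show ?case by simp
    qed
  qed measurable
  from order_tendstoD(2)[OF this \<open>e > 0\<close>] obtain n where "sqnorm (\<lambda>x. \<phi> n x - k x) < e"
    by (auto simp: eventually_sequentially)
  moreover have "bounded (range (\<phi> n))"
    using phi_bound by (auto simp: bounded_iff)
  ultimately show ?thesis
    using phi_L2 phi_cont by blast
qed

lemma L2_approx_continuous:
  fixes k :: "'a::euclidean_space \<Rightarrow> complex"
  assumes k: "k \<in> L2"
  shows "\<exists>\<phi>. (\<forall>n. \<phi> n \<in> L2 \<and> continuous_on UNIV (\<phi> n) \<and> bounded (range (\<phi> n))) \<and>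
    (\<lambda>n::nat. sqnorm (\<lambda>x. \<phi> n x - k x)) \<longlonglongrightarrow> 0"
proof -
  note [measurable] = k[THEN L2_measurable]
  define K where "K n x = (if norm x \<le> real n \<and> cmod (k x) \<le> real n then k x else 0)" for n x
  have [measurable]: "K n \<in> borel_measurable borel" for n
    unfolding K_def by measurable
  \<comment> \<open>\<open>Suc n\<close> in place of \<open>n\<close> keeps both the bound
    \<open>M\<close> and the tolerance positive at \<open>n = 0\<close>.\<close>
  have "\<exists>\<phi>\<in>L2. continuous_on UNIV \<phi> \<and> bounded (range \<phi>) \<and> sqnorm (\<lambda>x. \<phi> x - K n x) < ennreal (1 / real (Suc n))" for n
    by (rule L2_approx_continuous_bounded[where M="real (Suc n)"]) (auto simp: K_def)
  then obtain \<phi> where \<phi>: "\<And>n. \<phi> n \<in> L2" "\<And>n. continuous_on UNIV (\<phi> n)" "\<And>n. bounded (range (\<phi> n))"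
      "\<And>n. sqnorm (\<lambda>x. \<phi> n x - K n x) < ennreal (1 / real (Suc n))"
    by metis
  note [measurable] = \<phi>(1)[THEN L2_measurable]
  have "(\<lambda>n. 2 * ennreal (1 / real (Suc n)) + 2 * sqnorm (\<lambda>x. K n x - k x)) \<longlonglongrightarrow> 2 * ennreal 0 + 2 * 0"
    unfolding K_def
    by (intro tendsto_add tendsto_mult_ennreal tendsto_const tendsto_ennrealI LIMSEQ_Suc[OF lim_1_over_n]
        L2_truncate_tendsto k) auto
  then have lim: "(\<lambda>n. 2 * ennreal (1 / real (Suc n)) + 2 * sqnorm (\<lambda>x. K n x - k x)) \<longlonglongrightarrow> 0"
    by simp
  have "sqnorm (\<lambda>x. \<phi> n x - k x) \<le> 2 * ennreal (1 / real (Suc n)) + 2 * sqnorm (\<lambda>x. K n x - k x)" for n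
  proof -
    have "sqnorm (\<lambda>x. \<phi> n x - k x) = sqnorm (\<lambda>x. (\<phi> n x - K n x) + (K n x - k x))"
      by simp
    also have "\<dots> \<le> 2 * sqnorm (\<lambda>x. \<phi> n x - K n x) + 2 * sqnorm (\<lambda>x. K n x - k x)"
      by (rule sqnorm_add_le) measurable
    also have "\<dots> \<le> 2 * ennreal (1 / real (Suc n)) + 2 * sqnorm (\<lambda>x. K n x - k x)"
      using \<phi>(4)[of n] by (intro add_mono mult_left_mono) auto
    finally show ?thesis .
  qed
  then have "(\<lambda>n. sqnorm (\<lambda>x. \<phi> n x - k x)) \<longlonglongrightarrow> 0"
    by (intro tendsto_sandwich[OF _ _ tendsto_const lim] always_eventually allI) auto
  with \<phi> show ?thesis by blast
qed

section \<open>Gaussian averages as an approximate identity\<close>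

lemma gauss_smooth_tendsto:
  fixes \<phi> :: "'a::euclidean_space \<Rightarrow> complex"
  assumes "continuous_on UNIV \<phi>" "\<And>x. cmod (\<phi> x) \<le> B" "a \<longlonglongrightarrow> 0"
  shows "(\<lambda>n. gauss_smooth (a n) \<phi> x) \<longlonglongrightarrow> \<phi> x"
proof -
  have [measurable]: "\<phi> \<in> borel_measurable borel"
    by (rule borel_measurable_continuous_onI) fact
  have "(\<lambda>n. gauss_smooth (a n) \<phi> x) \<longlonglongrightarrow> (LBINT z::'a. complex_of_real (gauss z) * \<phi> x)"
    unfolding gauss_smooth_def
  proof (rule integral_dominated_convergence[where w="\<lambda>z. gauss z * B"])
    show "AE z in lborel. (\<lambda>n. complex_of_real (gauss z) * \<phi> (x + a n *\<^sub>R z)) \<longlonglongrightarrow> complex_of_real (gauss z) * \<phi> x"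
    proof (rule AE_I2)
      fix z
      have "(\<lambda>n. x + a n *\<^sub>R z) \<longlonglongrightarrow> x + 0 *\<^sub>R z"
        by (intro tendsto_intros assms)
      then have "(\<lambda>n. \<phi> (x + a n *\<^sub>R z)) \<longlonglongrightarrow> \<phi> x"
        using assms(1) by (auto intro: continuous_on_tendsto_compose)
      then show "(\<lambda>n. complex_of_real (gauss z) * \<phi> (x + a n *\<^sub>R z)) \<longlonglongrightarrow> complex_of_real (gauss z) * \<phi> x"
        by (intro tendsto_intros)
    qed
    show "AE z in lborel. norm (complex_of_real (gauss z) * \<phi> (x + a n *\<^sub>R z)) \<le> gauss z * B" for n
      using assms(2) by (auto simp: norm_mult intro!: mult_left_mono)
  qed (auto intro: integrable_gauss)
  also have "(LBINT z::'a. complex_of_real (gauss z) * \<phi> x) = \<phi> x"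
    by (simp add: integral_gauss integral_complex_of_real)
  finally show ?thesis .
qed

text \<open>For bounded continuous functions the averages converge pointwise and boundedly, and
  integrability of \<open>h\<close> gives the limit. The error of replacing \<open>k\<close> by such
  a function is uniform in \<open>n\<close>, since averaging does not increase the norm; here
  \<open>h\<close> enters as an L2 function.\<close>

lemma gauss_smooth_tendsto_weakly:
  fixes h k :: "'a::euclidean_space \<Rightarrow> complex"
  assumes h: "integrable lborel h" "h \<in> L2" and k: "k \<in> L2" and a: "a \<longlonglongrightarrow> 0" "\<And>n. a n \<noteq> 0"
  shows "(\<lambda>n. L2_inner h (gauss_smooth (a n) k)) \<longlonglongrightarrow> L2_inner h k"
proof -
  obtain \<phi> where \<phi>: "\<And>n. \<phi> n \<in> L2" "\<And>n. continuous_on UNIV (\<phi> n)" "\<And>n. bounded (range (\<phi> n))"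
      "(\<lambda>n. sqnorm (\<lambda>x. \<phi> n x - k x)) \<longlonglongrightarrow> 0"
    using L2_approx_continuous[OF k] by blast
  note [measurable] = \<phi>(1)[THEN L2_measurable] h(2)[THEN L2_measurable] k[THEN L2_measurable]
  have 1: "(\<lambda>n. L2_inner h (gauss_smooth (a n) (\<phi> m))) \<longlonglongrightarrow> L2_inner h (\<phi> m)" for m
  proof -
    obtain B where B: "\<And>x. cmod (\<phi> m x) \<le> B"
      using \<phi>(3)[of m] by (auto simp: bounded_iff)
    have sm: "cmod (gauss_smooth (a n) (\<phi> m) x) \<le> B" for n x
    proof -
      have "cmod (gauss_smooth (a n) (\<phi> m) x) \<le> (LBINT z::'a. gauss z * B)"
        unfolding gauss_smooth_def
      proof (rule Bochner_Integration.integral_norm_bound_integral)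
        show "integrable lborel (\<lambda>z. complex_of_real (gauss z) * \<phi> m (x + a n *\<^sub>R z))"
          by (intro integrable_gauss_smooth \<phi> a)
      qed (auto intro!: integrable_gauss mult_left_mono B simp: norm_mult)
      then show ?thesis by (simp add: integral_gauss)
    qed
    show ?thesis
      unfolding L2_inner_def
    proof (rule integral_dominated_convergence[where w="\<lambda>x. cmod (h x) * B"])
      show "AE x in lborel. (\<lambda>n. h x * cnj (gauss_smooth (a n) (\<phi> m) x)) \<longlonglongrightarrow> h x * cnj (\<phi> m x)"
        by (intro AE_I2 tendsto_intros gauss_smooth_tendsto[OF \<phi>(2) B] a)
      show "AE x in lborel. norm (h x * cnj (gauss_smooth (a n) (\<phi> m) x)) \<le> cmod (h x) * B" for n
        using sm by (auto simp: norm_mult intro!: mult_left_mono)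
    qed (use h in auto)
  qed
  show ?thesis
  proof (rule LIMSEQ_I)
    fix e :: real assume "e > 0"
    have "(\<lambda>m. sqnorm h * sqnorm (\<lambda>x. \<phi> m x - k x)) \<longlonglongrightarrow> sqnorm h * 0"
      using L2_sqnorm_finite[OF h(2)] by (intro tendsto_mult_ennreal \<phi> tendsto_const) auto
    then have "(\<lambda>m. sqnorm h * sqnorm (\<lambda>x. \<phi> m x - k x)) \<longlonglongrightarrow> 0"
      by simp
    then have "eventually (\<lambda>m. sqnorm h * sqnorm (\<lambda>x. \<phi> m x - k x) < ennreal ((e/3)\<^sup>2)) sequentially"
      by (rule order_tendstoD) (use \<open>e > 0\<close> in simp)
    then obtain m where m: "sqnorm h * sqnorm (\<lambda>x. \<phi> m x - k x) < ennreal ((e/3)\<^sup>2)"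
      by (auto simp: eventually_sequentially)
    \<comment> \<open>One estimate for both approximation errors: \<open>u\<close> will be
      \<open>\<phi> m - k\<close> itself and its Gaussian average.\<close>
    have small: "cmod (L2_inner h u) < e / 3" if "u \<in> L2" "sqnorm u \<le> sqnorm (\<lambda>x. \<phi> m x - k x)" for u
    proof -
      have "ennreal ((cmod (L2_inner h u))\<^sup>2) \<le> sqnorm h * sqnorm u"
        by (intro L2_Cauchy_Schwarz_inner h that)
      also have "\<dots> \<le> sqnorm h * sqnorm (\<lambda>x. \<phi> m x - k x)"
        by (intro mult_left_mono that) auto
      also note m
      finally have "(cmod (L2_inner h u))\<^sup>2 < (e/3)\<^sup>2"
        by (simp add: ennreal_less_iff)
      then show ?thesis
        by (rule power2_less_imp_less) (use \<open>e > 0\<close> in simp)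
    qed
    have inner_diff: "L2_inner h (\<lambda>x. u x - v x) = L2_inner h u - L2_inner h v" if "u \<in> L2" "v \<in> L2" for u v
      unfolding L2_inner_def using L2_inner_integrable[OF h(2) that(1)] L2_inner_integrable[OF h(2) that(2)]
      by (simp add: right_diff_distrib)
    have A: "cmod (L2_inner h (\<phi> m) - L2_inner h k) < e / 3"
      unfolding inner_diff[OF \<phi>(1) k, symmetric] by (intro small L2_diff \<phi> k) simp
    have B: "cmod (L2_inner h (gauss_smooth (a n) (\<phi> m)) - L2_inner h (gauss_smooth (a n) k)) < e / 3" for n
    proof -
      have "L2_inner h (gauss_smooth (a n) (\<phi> m)) - L2_inner h (gauss_smooth (a n) k)
          = L2_inner h (gauss_smooth (a n) (\<lambda>x. \<phi> m x - k x))"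
        by (simp add: gauss_smooth_diff[OF \<phi>(1) k a(2)] L2_gauss_smooth \<phi> k a flip: inner_diff)
      then show ?thesis
        by (simp only:) (intro small L2_gauss_smooth L2_diff \<phi> k a sqnorm_gauss_smooth_le)
    qed
    obtain N where N: "\<And>n. n \<ge> N \<Longrightarrow> cmod (L2_inner h (gauss_smooth (a n) (\<phi> m)) - L2_inner h (\<phi> m)) < e / 3"
      using LIMSEQ_D[OF 1[of m], of "e/3"] \<open>e > 0\<close> by auto
    have "cmod (L2_inner h (gauss_smooth (a n) k) - L2_inner h k) < e" if "n \<ge> N" for n
    proof -
      let ?S = "\<lambda>k. L2_inner h (gauss_smooth (a n) k)"
      have "cmod (?S k - L2_inner h k) \<le> cmod (?S (\<phi> m) - L2_inner h (\<phi> m)) + cmod (L2_inner h (\<phi> m) - L2_inner h k) + cmod (?S (\<phi> m) - ?S k)"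
        using norm_triangle_ineq4[of "?S (\<phi> m) - L2_inner h k" "?S (\<phi> m) - ?S k"]
          norm_triangle_ineq[of "?S (\<phi> m) - L2_inner h (\<phi> m)" "L2_inner h (\<phi> m) - L2_inner h k"]
        by simp
      also have "\<dots> < e"
        using N[OF that] A B[of n] by simp
      finally show ?thesis .
    qed
    then show "\<exists>N. \<forall>n\<ge>N. norm (L2_inner h (gauss_smooth (a n) k) - L2_inner h k) < e"
      by blast
  qed
qed

section \<open>The Fourier transform of integrable functions\<close>

definition L1_fourier :: "('a::euclidean_space \<Rightarrow> complex) \<Rightarrow> 'a \<Rightarrow> complex" where
  "L1_fourier h \<zeta> = complex_of_real ((2 * pi) powr (- real DIM('a) / 2)) *
    (LBINT x. h x * exp (- (\<i> * complex_of_real (x \<bullet> \<zeta>))))"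

lemma norm_exp_minus_ii [simp]: "cmod (exp (- (\<i> * complex_of_real r))) = 1"
  using norm_exp_i_times[of "- r"] by simp

lemma integrable_mult_exp_ii:
  fixes h :: "'a::euclidean_space \<Rightarrow> complex"
  assumes "integrable lborel h"
  shows "integrable lborel (\<lambda>x. h x * exp (- (\<i> * complex_of_real (x \<bullet> \<zeta>))))"
  by (rule Bochner_Integration.integrable_bound[OF assms])
     (use borel_measurable_integrable[OF assms] in \<open>auto simp: norm_mult\<close>)

lemma borel_measurable_L1_fourier [measurable]:
  assumes [measurable]: "h \<in> borel_measurable borel"
  shows "L1_fourier h \<in> borel_measurable borel"
  unfolding L1_fourier_def[abs_def] by measurable

lemma L1_fourier_bounded:
  fixes h :: "'a::euclidean_space \<Rightarrow> complex"
  assumes "integrable lborel h"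
  shows "cmod (L1_fourier h \<zeta>) \<le> (2 * pi) powr (- real DIM('a) / 2) * (LBINT x. cmod (h x))"
proof -
  have "cmod (LBINT x. h x * exp (- (\<i> * complex_of_real (x \<bullet> \<zeta>)))) \<le> (LBINT x. cmod (h x))"
    using integral_norm_bound[of lborel "\<lambda>x. h x * exp (- (\<i> * complex_of_real (x \<bullet> \<zeta>)))"]
    by (simp add: norm_mult)
  then show ?thesis
    by (simp add: L1_fourier_def norm_mult mult_left_mono)
qed

lemma integrable_bounded_mult:
  fixes f g :: "'a::euclidean_space \<Rightarrow> complex"
  assumes "integrable lborel f" and [measurable]: "g \<in> borel_measurable borel"
    and "\<And>x. cmod (g x) \<le> B"
  shows "integrable lborel (\<lambda>x. g x * f x)"
proof (rule Bochner_Integration.integrable_bound)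
  show "integrable lborel (\<lambda>x. B * cmod (f x))"
    using assms(1) by auto
  show "(\<lambda>x. g x * f x) \<in> borel_measurable lborel"
    using borel_measurable_integrable[OF assms(1)] by simp
  have "0 \<le> B"
    using norm_ge_zero assms(3) by (rule order_trans)
  then show "AE x in lborel. norm (g x * f x) \<le> norm (B * cmod (f x))"
    using assms(3) by (auto simp: norm_mult abs_mult intro!: mult_right_mono)
qed

lemma integrable_L1_fourier_mult:
  assumes "integrable lborel u" "integrable lborel v"
  shows "integrable lborel (\<lambda>x. L1_fourier u x * v x)"
  by (rule integrable_bounded_mult[OF assms(2) _ L1_fourier_bounded[OF assms(1)]])
     (use borel_measurable_integrable[OF assms(1)] in simp)

text \<open>Fubini: the kernel is symmetric in its two arguments and has modulus 1, so the double
  integral is dominated by the product of \<open>cmod (u x)\<close> and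
  \<open>cmod (v y)\<close>.\<close>

lemma L1_fourier_multiplication_formula:
  fixes u v :: "'a::euclidean_space \<Rightarrow> complex"
  assumes u: "integrable lborel u" and v: "integrable lborel v"
  shows "(LBINT x. L1_fourier u x * v x) = (LBINT x. u x * L1_fourier v x)"
proof -
  interpret lborel_pair: pair_sigma_finite "lborel :: 'a measure" "lborel :: 'a measure" ..
  note [measurable] = u[THEN borel_measurable_integrable] v[THEN borel_measurable_integrable]
  let ?e = "\<lambda>x y::'a. exp (- (\<i> * complex_of_real (x \<bullet> y)))"
  have int: "integrable (lborel \<Otimes>\<^sub>M lborel) (\<lambda>(x, y). u x * v y * ?e x y)"
  proof (rule lborel_pair.Fubini_integrable)
    show "(\<lambda>(x, y). u x * v y * ?e x y) \<in> borel_measurable (lborel \<Otimes>\<^sub>M lborel)"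
      by measurable
    show "integrable lborel (\<lambda>x. LBINT y. norm (case (x, y) of (x, y) \<Rightarrow> u x * v y * ?e x y))"
      using u by (simp add: norm_mult)
    show "AE x in lborel. integrable lborel (\<lambda>y. case (x, y) of (x, y) \<Rightarrow> u x * v y * ?e x y)"
    proof (rule AE_I2)
      fix x
      have "integrable lborel (\<lambda>y. u x * (v y * ?e y x))"
        by (intro Bochner_Integration.integrable_mult_right integrable_mult_exp_ii v)
      then show "integrable lborel (\<lambda>y. case (x, y) of (x, y) \<Rightarrow> u x * v y * ?e x y)"
        by (simp add: mult.assoc inner_commute)
    qed
  qed
  let ?C = "complex_of_real ((2 * pi) powr (- real DIM('a) / 2))"
  have "(LBINT y. L1_fourier u y * v y) = ?C * (LBINT y. LBINT x. u x * v y * ?e x y)"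
    by (simp add: L1_fourier_def mult.assoc flip: integral_mult_left_zero integral_mult_right_zero)
       (simp add: ac_simps)
  also have "(LBINT y. LBINT x. u x * v y * ?e x y) = (LBINT x. LBINT y. u x * v y * ?e x y)"
    using lborel_pair.Fubini_integral[OF int] by simp
  also have "?C * \<dots> = (LBINT x. u x * L1_fourier v x)"
    by (simp add: L1_fourier_def mult.assoc inner_commute flip: integral_mult_left_zero integral_mult_right_zero)
       (simp add: ac_simps)
  finally show ?thesis .
qed

text \<open>Unnormalised, unlike \<open>gauss\<close>: it is bounded by 1 and tends to 1 as
  \<open>a\<close> tends to 0, so it regularises frequency integrals without changing their
  limit.\<close>

definition gauss_weight :: "real \<Rightarrow> 'a::euclidean_space \<Rightarrow> complex" where
  "gauss_weight a \<zeta> = complex_of_real (exp (- (norm (a *\<^sub>R \<zeta>))\<^sup>2 / 2))"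

lemma borel_measurable_gauss_weight [measurable]: "gauss_weight a \<in> borel_measurable borel"
  unfolding gauss_weight_def[abs_def] by measurable

lemma norm_gauss_weight_le_1: "cmod (gauss_weight a \<zeta>) \<le> 1"
  by (simp add: gauss_weight_def)

lemma gauss_weight_tendsto:
  assumes "a \<longlonglongrightarrow> 0"
  shows "(\<lambda>n. gauss_weight (a n) \<zeta>) \<longlonglongrightarrow> 1"
proof -
  have "(\<lambda>n. gauss_weight (a n) \<zeta>) \<longlonglongrightarrow> complex_of_real (exp (- (norm (0 *\<^sub>R \<zeta>))\<^sup>2 / 2))"
    unfolding gauss_weight_def by (intro tendsto_intros assms) auto
  then show ?thesis by simp
qed

lemma gauss_weight_eq:
  "gauss_weight a (\<zeta>::'a::euclidean_space) = complex_of_real ((2 * pi) powr (real DIM('a) / 2)) * complex_of_real (gauss (a *\<^sub>R \<zeta>))"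
  unfolding gauss_weight_def gauss_eq of_real_mult[symmetric] mult.assoc[symmetric] powr_add[symmetric]
  by simp

lemma integrable_gauss_weight:
  assumes "a \<noteq> 0"
  shows "integrable lborel (gauss_weight a :: 'a::euclidean_space \<Rightarrow> complex)"
  unfolding gauss_weight_eq[abs_def]
  using integrable_lborel_affine[OF integrable_gauss assms, of 0]
  by (intro Bochner_Integration.integrable_mult_right integrable_of_real) simp

text \<open>The self-duality of the Gaussian, rescaled: \<open>gauss_char\<close> is used at the
  frequency (y - x) / a after the substitution z = a \<zeta>, and the modulation by \<open>x\<close>
  shifts the centre.\<close>

lemma L1_fourier_gauss_weight:
  fixes x y :: "'a::euclidean_space"
  assumes a: "a > 0"
  shows "L1_fourier (\<lambda>\<zeta>. gauss_weight a \<zeta> * exp (\<i> * complex_of_real (\<zeta> \<bullet> x))) y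
    = complex_of_real ((2 * pi) powr (real DIM('a) / 2) / a ^ DIM('a) * gauss ((1 / a) *\<^sub>R (y - x)))"
proof -
  let ?g = "\<lambda>z::'a. complex_of_real (gauss z)" and ?\<xi> = "(1 / a) *\<^sub>R (y - x)"
  let ?p = "(2 * pi) powr (real DIM('a) / 2)" and ?m = "(2 * pi) powr (- real DIM('a) / 2)"
  have pm: "?m * ?p = 1" "?p * ?m = 1"
    unfolding powr_add[symmetric] by simp_all
  have "complex_of_real (exp (- (norm ?\<xi>)\<^sup>2 / 2)) = (LBINT z. ?g z * exp (- (\<i> * complex_of_real (z \<bullet> ?\<xi>))))"
    by (rule gauss_char[symmetric])
  also have "\<dots> = a ^ DIM('a) *\<^sub>R (LBINT \<zeta>. ?g (a *\<^sub>R \<zeta>) * exp (- (\<i> * complex_of_real ((a *\<^sub>R \<zeta>) \<bullet> ?\<xi>))))"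
    using integral_lborel_affine[OF integrable_mult_exp_ii[OF integrable_of_real[OF integrable_gauss]], of a ?\<xi> 0] a
    by simp
  also have "(LBINT \<zeta>. ?g (a *\<^sub>R \<zeta>) * exp (- (\<i> * complex_of_real ((a *\<^sub>R \<zeta>) \<bullet> ?\<xi>))))
      = (LBINT \<zeta>. complex_of_real ?m * (gauss_weight a \<zeta> * exp (\<i> * complex_of_real (\<zeta> \<bullet> x)) * exp (- (\<i> * complex_of_real (\<zeta> \<bullet> y)))))"
  proof (rule Bochner_Integration.integral_cong[OF refl])
    fix \<zeta> :: 'a
    have "- (\<i> * complex_of_real ((a *\<^sub>R \<zeta>) \<bullet> ?\<xi>)) = \<i> * complex_of_real (\<zeta> \<bullet> x) + - (\<i> * complex_of_real (\<zeta> \<bullet> y))"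
      using a by (simp add: inner_diff_right algebra_simps)
    then have e: "exp (- (\<i> * complex_of_real ((a *\<^sub>R \<zeta>) \<bullet> ?\<xi>)))
      = exp (\<i> * complex_of_real (\<zeta> \<bullet> x)) * exp (- (\<i> * complex_of_real (\<zeta> \<bullet> y)))"
      by (simp only: exp_add)
    have "?g (a *\<^sub>R \<zeta>) = complex_of_real ?m * gauss_weight a \<zeta>"
      unfolding gauss_weight_eq of_real_mult[symmetric] mult.assoc[symmetric] pm by simp
    then show "?g (a *\<^sub>R \<zeta>) * exp (- (\<i> * complex_of_real ((a *\<^sub>R \<zeta>) \<bullet> ?\<xi>)))
      = complex_of_real ?m * (gauss_weight a \<zeta> * exp (\<i> * complex_of_real (\<zeta> \<bullet> x)) * exp (- (\<i> * complex_of_real (\<zeta> \<bullet> y))))"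
      unfolding e by (simp only: mult.assoc)
  qed
  also have "\<dots> = L1_fourier (\<lambda>\<zeta>. gauss_weight a \<zeta> * exp (\<i> * complex_of_real (\<zeta> \<bullet> x))) y"
    by (simp add: L1_fourier_def)
  finally have *: "complex_of_real (exp (- (norm ?\<xi>)\<^sup>2 / 2))
      = a ^ DIM('a) *\<^sub>R L1_fourier (\<lambda>\<zeta>. gauss_weight a \<zeta> * exp (\<i> * complex_of_real (\<zeta> \<bullet> x))) y" .
  have "exp (- (norm ?\<xi>)\<^sup>2 / 2) = ?p * gauss ?\<xi>"
    unfolding gauss_eq mult.assoc[symmetric] pm by simp
  with * a show ?thesis
    by (simp add: scaleR_conv_of_real field_simps)
qed

text \<open>A regularised inversion formula. The multiplication formula moves the transform onto the
  modulated weight, and y = x + a z absorbs the factor a^(-d).\<close>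

lemma integral_L1_fourier_gauss_weight:
  fixes k :: "'a::euclidean_space \<Rightarrow> complex"
  assumes k: "integrable lborel k" and a: "a > 0"
  shows "(LBINT \<zeta>. L1_fourier k \<zeta> * (gauss_weight a \<zeta> * exp (\<i> * complex_of_real (\<zeta> \<bullet> x))))
    = complex_of_real ((2 * pi) powr (real DIM('a) / 2)) * gauss_smooth a k x"
proof -
  let ?v = "\<lambda>\<zeta>::'a. gauss_weight a \<zeta> * exp (\<i> * complex_of_real (\<zeta> \<bullet> x))"
  let ?p = "(2 * pi) powr (real DIM('a) / 2)"
  have "integrable lborel ?v"
    using integrable_mult_exp_ii[OF integrable_gauss_weight[of a], of "- x"] a by simp
  then have "(LBINT \<zeta>. L1_fourier k \<zeta> * ?v \<zeta>) = (LBINT y. k y * L1_fourier ?v y)"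
    by (rule L1_fourier_multiplication_formula[OF k])
  also have "\<dots> = (LBINT y. complex_of_real (?p / a ^ DIM('a)) * (complex_of_real (gauss ((1 / a) *\<^sub>R (y - x))) * k y))"
    unfolding L1_fourier_gauss_weight[OF a] by (simp add: ac_simps)
  also have "\<dots> = complex_of_real (?p / a ^ DIM('a)) * (LBINT y. complex_of_real (gauss ((1 / a) *\<^sub>R (y - x))) * k y)"
    by (rule integral_mult_right_zero)
  also have "(LBINT y. complex_of_real (gauss ((1 / a) *\<^sub>R (y - x))) * k y)
      = a ^ DIM('a) *\<^sub>R (LBINT z. complex_of_real (gauss ((1 / a) *\<^sub>R ((x + a *\<^sub>R z) - x))) * k (x + a *\<^sub>R z))"
  proof -
    have "integrable lborel (\<lambda>y. complex_of_real (gauss ((1 / a) *\<^sub>R (y - x))) * k y)"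
      by (rule integrable_bounded_mult[OF k, of _ 1]) (auto simp: gauss_le_1)
    from integral_lborel_affine[OF this, of a x] a show ?thesis by simp
  qed
  also have "\<dots> = complex_of_real (a ^ DIM('a)) * gauss_smooth a k x"
    using a by (simp add: gauss_smooth_def scaleR_conv_of_real)
  finally show ?thesis
    using a by simp
qed

text \<open>Both transforms are moved across by the multiplication formula, so no triple integral is
  needed: the Gaussian weight on the frequency side becomes averaging on the space side.\<close>

lemma L1_fourier_weighted_Parseval:
  fixes h k :: "'a::euclidean_space \<Rightarrow> complex"
  assumes h: "integrable lborel h" and k: "integrable lborel k" and a: "a > 0"
  shows "(LBINT \<zeta>. L1_fourier h \<zeta> * (cnj (L1_fourier k \<zeta>) * gauss_weight a \<zeta>)) = L2_inner h (gauss_smooth a k)"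
proof -
  note [measurable] = h[THEN borel_measurable_integrable] k[THEN borel_measurable_integrable]
  let ?w = "\<lambda>\<zeta>. cnj (L1_fourier k \<zeta>) * gauss_weight a \<zeta>"
  have "integrable lborel ?w"
    by (rule integrable_bounded_mult[OF integrable_gauss_weight])
       (use a L1_fourier_bounded[OF k] in auto)
  then have "(LBINT \<zeta>. L1_fourier h \<zeta> * ?w \<zeta>) = (LBINT x. h x * L1_fourier ?w x)"
    by (rule L1_fourier_multiplication_formula[OF h])
  also have "\<dots> = L2_inner h (gauss_smooth a k)"
    unfolding L2_inner_def
  proof (rule Bochner_Integration.integral_cong[OF refl])
    fix x :: 'a
    \<comment> \<open>The weight is real, so conjugating the integrand only flips the sign in the
      exponential and leads to the regularised inversion formula for \<open>k\<close>.\<close>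
    have "(LBINT \<zeta>. ?w \<zeta> * exp (- (\<i> * complex_of_real (\<zeta> \<bullet> x))))
        = (LBINT \<zeta>. cnj (L1_fourier k \<zeta> * (gauss_weight a \<zeta> * exp (\<i> * complex_of_real (\<zeta> \<bullet> x)))))"
      by (simp add: gauss_weight_def exp_cnj mult.assoc)
    also have "\<dots> = cnj (LBINT \<zeta>. L1_fourier k \<zeta> * (gauss_weight a \<zeta> * exp (\<i> * complex_of_real (\<zeta> \<bullet> x))))"
      by (rule Bochner_Integration.integral_cnj)
    also have "\<dots> = complex_of_real ((2 * pi) powr (real DIM('a) / 2)) * cnj (gauss_smooth a k x)"
      unfolding integral_L1_fourier_gauss_weight[OF k a] by simp
    finally have "L1_fourier ?w x = complex_of_real ((2 * pi) powr (- real DIM('a) / 2) * (2 * pi) powr (real DIM('a) / 2)) * cnj (gauss_smooth a k x)"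
      by (simp add: L1_fourier_def)
    then show "h x * L1_fourier ?w x = h x * cnj (gauss_smooth a k x)"
      unfolding powr_add[symmetric] by simp
  qed
  finally show ?thesis .
qed

text \<open>The weighted integral is the modulus of the inner product of \<open>h\<close> with its
  average, hence at most the squared norm of \<open>h\<close>, uniformly in the weight. Fatou's
  lemma removes the weight, since no integrable majorant is known yet.\<close>

lemma L1_fourier_contraction:
  fixes h :: "'a::euclidean_space \<Rightarrow> complex"
  assumes h: "integrable lborel h" "h \<in> L2"
  shows "sqnorm (L1_fourier h) \<le> sqnorm h"
proof -
  note [measurable] = h(1)[THEN borel_measurable_integrable]
  define a where "a n = 1 / real (Suc n)" for n
  have a0: "a \<longlonglongrightarrow> 0" and a_pos: "a n > 0" for n
    unfolding a_def by (rule LIMSEQ_Suc[OF lim_1_over_n], simp)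
  define w where "w n \<zeta> = (cmod (L1_fourier h \<zeta>))\<^sup>2 * exp (- (norm (a n *\<^sub>R \<zeta>))\<^sup>2 / 2)" for n \<zeta>
  have [measurable]: "w n \<in> borel_measurable borel" for n
    unfolding w_def by measurable
  have w_eq: "complex_of_real (w n \<zeta>) = L1_fourier h \<zeta> * (cnj (L1_fourier h \<zeta>) * gauss_weight (a n) \<zeta>)" for n \<zeta>
    unfolding w_def gauss_weight_def of_real_mult complex_norm_square by (simp only: mult.assoc)
  have int: "integrable lborel (w n)" for n
  proof -
    have "integrable lborel (\<lambda>\<zeta>. L1_fourier h \<zeta> * (cnj (L1_fourier h \<zeta>) * gauss_weight (a n) \<zeta>))"
      by (intro integrable_L1_fourier_mult h integrable_bounded_mult[OF integrable_gauss_weight])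
         (use a_pos[of n] L1_fourier_bounded[OF h(1)] in auto)
    then show ?thesis
      unfolding w_eq[symmetric] by (simp add: complex_of_real_integrable_eq)
  qed
  have w_bound: "(\<integral>\<^sup>+\<zeta>. ennreal (w n \<zeta>) \<partial>lborel) \<le> sqnorm h" for n
  proof -
    have nn: "0 \<le> (LBINT \<zeta>. w n \<zeta>)"
      by (simp add: w_def integral_nonneg_AE)
    have "complex_of_real (LBINT \<zeta>. w n \<zeta>) = L2_inner h (gauss_smooth (a n) h)"
      unfolding integral_complex_of_real[symmetric] w_eq
      by (rule L1_fourier_weighted_Parseval[OF h(1) h(1) a_pos])
    then have "cmod (L2_inner h (gauss_smooth (a n) h)) = (LBINT \<zeta>. w n \<zeta>)"
      using nn by (metis norm_of_real abs_of_nonneg)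
    then have "ennreal ((LBINT \<zeta>. w n \<zeta>)\<^sup>2) \<le> sqnorm h * sqnorm (gauss_smooth (a n) h)"
      using L2_Cauchy_Schwarz_inner[OF h(2) L2_gauss_smooth[OF h(2)], of "a n"] a_pos[of n] by simp
    also have "\<dots> \<le> sqnorm h * sqnorm h"
      using sqnorm_gauss_smooth_le[OF h(2), of "a n"] a_pos[of n] by (intro mult_left_mono) auto
    also have "\<dots> = ennreal ((LBINT x. (cmod (h x))\<^sup>2)\<^sup>2)"
      by (simp add: sqnorm_eq_integral[OF h(2)] power2_eq_square ennreal_mult)
    finally have "(LBINT \<zeta>. w n \<zeta>)\<^sup>2 \<le> (LBINT x. (cmod (h x))\<^sup>2)\<^sup>2"
      by (simp add: ennreal_le_iff)
    then have "(LBINT \<zeta>. w n \<zeta>) \<le> (LBINT x. (cmod (h x))\<^sup>2)"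
      by (rule power2_le_imp_le) simp
    moreover have "(\<integral>\<^sup>+\<zeta>. ennreal (w n \<zeta>) \<partial>lborel) = ennreal (LBINT \<zeta>. w n \<zeta>)"
      by (rule nn_integral_eq_integral[OF int]) (simp add: w_def)
    ultimately show ?thesis
      by (simp add: sqnorm_eq_integral[OF h(2)] ennreal_leI)
  qed
  have "sqnorm (L1_fourier h) = (\<integral>\<^sup>+\<zeta>. liminf (\<lambda>n. ennreal (w n \<zeta>)) \<partial>lborel)"
    unfolding sqnorm_def
  proof (rule nn_integral_cong)
    fix \<zeta> :: 'a
    have "(\<lambda>n. exp (- (norm (a n *\<^sub>R \<zeta>))\<^sup>2 / 2)) \<longlonglongrightarrow> exp (- (norm (0 *\<^sub>R \<zeta>))\<^sup>2 / 2)"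
      by (intro tendsto_intros a0) auto
    then have "(\<lambda>n. ennreal (w n \<zeta>)) \<longlonglongrightarrow> ennreal ((cmod (L1_fourier h \<zeta>))\<^sup>2 * exp (- (norm (0 *\<^sub>R \<zeta>))\<^sup>2 / 2))"
      unfolding w_def by (intro tendsto_ennrealI tendsto_mult tendsto_const)
    from lim_imp_Liminf[OF _ this]
    show "ennreal ((cmod (L1_fourier h \<zeta>))\<^sup>2) = liminf (\<lambda>n. ennreal (w n \<zeta>))"
      by simp
  qed
  also have "\<dots> \<le> liminf (\<lambda>n. \<integral>\<^sup>+\<zeta>. ennreal (w n \<zeta>) \<partial>lborel)"
    by (rule nn_integral_liminf) measurable
  also have "\<dots> \<le> liminf (\<lambda>n::nat. sqnorm h)"
    by (intro Liminf_mono always_eventually allI w_bound)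
  also have "\<dots> = sqnorm h"
    by (simp add: Liminf_const)
  finally show ?thesis .
qed

lemma L2_L1_fourier:
  assumes h: "integrable lborel h" "h \<in> L2"
  shows "L1_fourier h \<in> L2"
  by (rule L2I_sqnorm[OF _ le_less_trans[OF L1_fourier_contraction[OF h] L2_sqnorm_finite[OF h(2)]]])
     (use L2_measurable[OF h(2)] in measurable)

text \<open>Two limits of one sequence: on the frequency side by dominated convergence, now that
  both transforms lie in L2, and on the space side by weak convergence of the averages.\<close>

lemma L1_fourier_Parseval:
  fixes h k :: "'a::euclidean_space \<Rightarrow> complex"
  assumes h: "integrable lborel h" "h \<in> L2" and k: "integrable lborel k" "k \<in> L2"
  shows "L2_inner (L1_fourier h) (L1_fourier k) = L2_inner h k"
proof (rule LIMSEQ_unique)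
  define a where "a n = 1 / real (Suc n)" for n
  have a: "a \<longlonglongrightarrow> 0" "\<And>n. a n \<noteq> 0" and a_pos: "a n > 0" for n
    unfolding a_def by (rule LIMSEQ_Suc[OF lim_1_over_n], simp_all)
  show "(\<lambda>n. L2_inner h (gauss_smooth (a n) k)) \<longlonglongrightarrow> L2_inner h k"
    by (rule gauss_smooth_tendsto_weakly[OF h k(2) a])
  have FF: "L1_fourier h \<in> L2" "L1_fourier k \<in> L2"
    using h k by (auto intro: L2_L1_fourier)
  note [measurable] = FF[THEN L2_measurable]
  have "(\<lambda>n. LBINT \<zeta>. L1_fourier h \<zeta> * (cnj (L1_fourier k \<zeta>) * gauss_weight (a n) \<zeta>)) \<longlonglongrightarrow> L2_inner (L1_fourier h) (L1_fourier k)"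
    unfolding L2_inner_def
  proof (rule integral_dominated_convergence[where w="\<lambda>\<zeta>. cmod (L1_fourier h \<zeta> * cnj (L1_fourier k \<zeta>))"])
    show "integrable lborel (\<lambda>\<zeta>. cmod (L1_fourier h \<zeta> * cnj (L1_fourier k \<zeta>)))"
      by (intro integrable_norm L2_inner_integrable FF)
    show "AE \<zeta> in lborel. (\<lambda>n. L1_fourier h \<zeta> * (cnj (L1_fourier k \<zeta>) * gauss_weight (a n) \<zeta>)) \<longlonglongrightarrow> L1_fourier h \<zeta> * cnj (L1_fourier k \<zeta>)"
    proof (rule AE_I2)
      fix \<zeta>
      have "(\<lambda>n. L1_fourier h \<zeta> * (cnj (L1_fourier k \<zeta>) * gauss_weight (a n) \<zeta>)) \<longlonglongrightarrow> L1_fourier h \<zeta> * (cnj (L1_fourier k \<zeta>) * 1)"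
        by (intro tendsto_intros gauss_weight_tendsto a)
      then show "(\<lambda>n. L1_fourier h \<zeta> * (cnj (L1_fourier k \<zeta>) * gauss_weight (a n) \<zeta>)) \<longlonglongrightarrow> L1_fourier h \<zeta> * cnj (L1_fourier k \<zeta>)"
        by simp
    qed
    show "AE \<zeta> in lborel. norm (L1_fourier h \<zeta> * (cnj (L1_fourier k \<zeta>) * gauss_weight (a n) \<zeta>))
        \<le> cmod (L1_fourier h \<zeta> * cnj (L1_fourier k \<zeta>))" for n
      by (auto simp: norm_mult intro!: mult_left_mono mult_left_le norm_gauss_weight_le_1)
  qed measurable
  then show "(\<lambda>n. L2_inner h (gauss_smooth (a n) k)) \<longlonglongrightarrow> L2_inner (L1_fourier h) (L1_fourier k)"
    by (simp add: L1_fourier_weighted_Parseval[OF h(1) k(1) a_pos])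
qed

section \<open>The unitary Fourier transform\<close>

text \<open>The truncation is moved from the domain of integration into the function, which makes
  \<open>truncated_fourier\<close> an \<open>L1_fourier\<close> of a function that is both
  integrable and in L2.\<close>

definition ball_restrict :: "nat \<Rightarrow> ('a::euclidean_space \<Rightarrow> complex) \<Rightarrow> 'a \<Rightarrow> complex" where
  "ball_restrict n f x = (if norm x \<le> real n then f x else 0)"

lemma truncated_fourier_eq: "truncated_fourier n f = L1_fourier (ball_restrict n f)"
  unfolding truncated_fourier_def[abs_def] L1_fourier_def[abs_def] set_lebesgue_integral_def
  by (intro ext arg_cong2[where f="(*)"] refl Bochner_Integration.integral_cong)
     (auto simp: ball_restrict_def indicator_def)

lemma L2_ball_restrict: "f \<in> L2 \<Longrightarrow> ball_restrict n f \<in> L2"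
  by (rule L2_dominated[of f])
     (use L2_measurable[of f] in \<open>auto simp: ball_restrict_def[abs_def]\<close>)

lemma integrable_ball_restrict:
  fixes f :: "'a::euclidean_space \<Rightarrow> complex"
  assumes "f \<in> L2"
  shows "integrable lborel (ball_restrict n f)"
proof -
  \<comment> \<open>The restriction is a product of \<open>f\<close> with the indicator of a ball,
    both in L2.\<close>
  have "ball_restrict n (\<lambda>_::'a. 1) \<in> L2"
    by (rule L2_bounded_compact_support[of _ 1 "real n"]) (auto simp: ball_restrict_def[abs_def])
  from L2_integrable_mult[OF this assms]
  show ?thesis
    by (rule Bochner_Integration.integrable_cong[THEN iffD1, OF refl, rotated])
       (simp add: ball_restrict_def)
qed

lemma ball_restrict_tendsto:
  fixes f :: "'a::euclidean_space \<Rightarrow> complex"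
  assumes f: "f \<in> L2"
  shows "(\<lambda>n. sqnorm (\<lambda>x. ball_restrict n f x - f x)) \<longlonglongrightarrow> 0"
proof (rule tendsto_sqnorm_dominated[OF _ _ f])
  show "AE x in lborel. (\<lambda>n. ball_restrict n f x) \<longlonglongrightarrow> f x"
  proof (rule AE_I2)
    fix x :: 'a
    obtain N where "norm x \<le> real N"
      using real_arch_simple by blast
    then have "eventually (\<lambda>n. ball_restrict n f x = f x) sequentially"
      by (auto simp: eventually_sequentially ball_restrict_def intro!: exI[of _ N])
    then show "(\<lambda>n. ball_restrict n f x) \<longlonglongrightarrow> f x"
      by (rule tendsto_eventually)
  qed
qed (use L2_measurable[OF f] L2_measurable[OF L2_ball_restrict[OF f]] in \<open>auto simp: ball_restrict_def\<close>)

lemma L1_fourier_diff: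
  assumes "integrable lborel f" "integrable lborel g"
  shows "L1_fourier (\<lambda>x. f x - g x) = (\<lambda>\<zeta>. L1_fourier f \<zeta> - L1_fourier g \<zeta>)"
  unfolding L1_fourier_def[abs_def]
  using assms[THEN integrable_mult_exp_ii] by (simp add: left_diff_distrib right_diff_distrib)

lemma L2_truncated_fourier: "f \<in> L2 \<Longrightarrow> truncated_fourier n f \<in> L2"
  unfolding truncated_fourier_eq by (intro L2_L1_fourier integrable_ball_restrict L2_ball_restrict)

text \<open>By the contraction property the truncated transforms differ by at most the tail of
  \<open>f\<close> outside the smaller ball, a bound independent of the larger one. Completeness
  then gives a limit, so the choice in \<open>fourier\<close> is made from a nonempty set.\<close>

lemma
  assumes f: "f \<in> L2"
  shows L2_fourier: "fourier f \<in> L2"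
    and fourier_tendsto: "(\<lambda>n. sqnorm (\<lambda>\<zeta>. truncated_fourier n f \<zeta> - fourier f \<zeta>)) \<longlonglongrightarrow> 0"
proof -
  have "\<exists>g\<in>L2. (\<lambda>n. sqnorm (\<lambda>\<zeta>. truncated_fourier n f \<zeta> - g \<zeta>)) \<longlonglongrightarrow> 0"
  proof (rule L2_complete[OF L2_truncated_fourier[OF f] _ ball_restrict_tendsto[OF f]])
    fix m n :: nat assume "n \<le> m"
    note r = integrable_ball_restrict[OF f] L2_ball_restrict[OF f]
    have "sqnorm (\<lambda>\<zeta>. truncated_fourier m f \<zeta> - truncated_fourier n f \<zeta>)
        = sqnorm (L1_fourier (\<lambda>x. ball_restrict m f x - ball_restrict n f x))"
      by (simp add: truncated_fourier_eq L1_fourier_diff r)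
    also have "\<dots> \<le> sqnorm (\<lambda>x. ball_restrict m f x - ball_restrict n f x)"
      by (intro L1_fourier_contraction Bochner_Integration.integrable_diff L2_diff r)
    also have "\<dots> \<le> sqnorm (\<lambda>x. ball_restrict n f x - f x)"
      using \<open>n \<le> m\<close> by (intro sqnorm_mono) (auto simp: ball_restrict_def)
    finally show "sqnorm (\<lambda>\<zeta>. truncated_fourier m f \<zeta> - truncated_fourier n f \<zeta>) \<le> sqnorm (\<lambda>x. ball_restrict n f x - f x)" .
  qed
  then have "\<exists>g. g \<in> L2 \<and> (\<lambda>n. \<integral>\<^sup>+ \<zeta>. ennreal ((cmod (truncated_fourier n f \<zeta> - g \<zeta>))\<^sup>2) \<partial>lborel) \<longlonglongrightarrow> 0"
    by (auto simp: sqnorm_def)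
  from someI_ex[OF this] show "fourier f \<in> L2"
      "(\<lambda>n. sqnorm (\<lambda>\<zeta>. truncated_fourier n f \<zeta> - fourier f \<zeta>)) \<longlonglongrightarrow> 0"
    unfolding fourier_def[symmetric] by (auto simp: sqnorm_def)
qed

lemma tendsto_sqnorm_cnj:
  "(\<lambda>n. sqnorm (\<lambda>x. f n x - g x)) \<longlonglongrightarrow> 0 \<Longrightarrow> (\<lambda>n. sqnorm (\<lambda>x. cnj (f n x) - cnj (g x))) \<longlonglongrightarrow> 0"
  by (simp add: sqnorm_def flip: complex_cnj_diff)

lemma fourier_Parseval:
  assumes f: "f \<in> L2" and g: "g \<in> L2"
  shows "L2_inner (fourier f) (fourier g) = L2_inner f g"
proof (rule LIMSEQ_unique)
  show "(\<lambda>n. L2_inner (truncated_fourier n f) (truncated_fourier n g)) \<longlonglongrightarrow> L2_inner (fourier f) (fourier g)"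
    unfolding L2_inner_def
    by (intro L2_tendsto_integral_mult_both tendsto_sqnorm_cnj L2_cnj fourier_tendsto L2_fourier L2_truncated_fourier f g)
  have "(\<lambda>n. L2_inner (ball_restrict n f) (ball_restrict n g)) \<longlonglongrightarrow> L2_inner f g"
    unfolding L2_inner_def
    by (intro L2_tendsto_integral_mult_both tendsto_sqnorm_cnj L2_cnj ball_restrict_tendsto L2_ball_restrict f g)
  then show "(\<lambda>n. L2_inner (truncated_fourier n f) (truncated_fourier n g)) \<longlonglongrightarrow> L2_inner f g"
    by (simp add: truncated_fourier_eq L1_fourier_Parseval integrable_ball_restrict L2_ball_restrict f g)
qed

text \<open>The version for integrable functions requires both functions to be cut off, so both
  factors move in each limit.\<close>

lemma fourier_multiplication_formula:
  assumes f: "f \<in> L2" and g: "g \<in> L2"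
  shows "(LBINT x. fourier f x * g x) = (LBINT x. f x * fourier g x)"
proof (rule LIMSEQ_unique)
  show "(\<lambda>n. LBINT x. truncated_fourier n f x * ball_restrict n g x) \<longlonglongrightarrow> (LBINT x. fourier f x * g x)"
    by (intro L2_tendsto_integral_mult_both fourier_tendsto L2_fourier L2_truncated_fourier
        ball_restrict_tendsto L2_ball_restrict f g)
  have "(\<lambda>n. LBINT x. ball_restrict n f x * truncated_fourier n g x) \<longlonglongrightarrow> (LBINT x. f x * fourier g x)"
    by (intro L2_tendsto_integral_mult_both fourier_tendsto L2_fourier L2_truncated_fourier
        ball_restrict_tendsto L2_ball_restrict f g)
  then show "(\<lambda>n. LBINT x. truncated_fourier n f x * ball_restrict n g x) \<longlonglongrightarrow> (LBINT x. f x * fourier g x)"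
    by (simp add: truncated_fourier_eq L1_fourier_multiplication_formula integrable_ball_restrict f g)
qed

text \<open>Fourier inversion by duality: the multiplication formula and Parseval's identity show that
  both sides pair identically with every \<open>v\<close> in \<open>L\<^sup>2\<close>. Since \<open>f \<mapsto> cnj \<circ> fourier f\<close> is thus an
  involution, surjectivity comes for free.\<close>

lemma fourier_cnj_fourier:
  fixes f :: "'a::euclidean_space \<Rightarrow> complex"
  assumes f: "f \<in> L2"
  shows "AE \<zeta> in lborel. fourier (\<lambda>x. cnj (fourier f x)) \<zeta> = cnj (f \<zeta>)"
proof (rule L2_eq_AE_if_integral_mult_eq)
  fix v :: "'a \<Rightarrow> complex" assume v: "v \<in> L2"
  have "(LBINT x. v x * fourier (\<lambda>x. cnj (fourier f x)) x) = L2_inner (fourier v) (fourier f)"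
    unfolding L2_inner_def by (rule fourier_multiplication_formula[symmetric]) (intro v L2_cnj L2_fourier f)+
  also have "\<dots> = L2_inner v f"
    by (rule fourier_Parseval[OF v f])
  finally show "(LBINT x. v x * fourier (\<lambda>x. cnj (fourier f x)) x) = (LBINT x. v x * cnj (f x))"
    by (simp add: L2_inner_def)
qed (intro L2_fourier L2_cnj f)+

text \<open>The preimage is the conjugate of the transform of the conjugate of
  \<open>g\<close>.\<close>

lemma fourier_surj:
  assumes "g \<in> L2"
  shows "\<exists>f\<in>L2. AE \<zeta> in lborel. fourier f \<zeta> = g \<zeta>"
  using fourier_cnj_fourier[OF L2_cnj[OF assms]] L2_cnj[OF L2_fourier[OF L2_cnj[OF assms]]]
  by auto

text \<open>The assumption says that \<open>f\<close> is in the domain of the operator; surjectivity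
  of the transform then provides a function from which the choice can be made.\<close>

lemma
  assumes "(\<lambda>\<zeta>. complex_of_real (m \<zeta>) * fourier f \<zeta>) \<in> L2"
  shows L2_fourier_multiplier: "fourier_multiplier m f \<in> L2"
    and fourier_fourier_multiplier:
      "AE \<zeta> in lborel. fourier (fourier_multiplier m f) \<zeta> = complex_of_real (m \<zeta>) * fourier f \<zeta>"
proof -
  have "\<exists>g. g \<in> L2 \<and> (AE \<zeta> in lborel. fourier g \<zeta> = complex_of_real (m \<zeta>) * fourier f \<zeta>)"
    using fourier_surj[OF assms] by blast
  from someI_ex[OF this] show "fourier_multiplier m f \<in> L2"
      "AE \<zeta> in lborel. fourier (fourier_multiplier m f) \<zeta> = complex_of_real (m \<zeta>) * fourier f \<zeta>"
    unfolding fourier_multiplier_def by auto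
qed

section \<open>Fourier multipliers and the integral representation\<close>

lemma
  fixes s :: real
  assumes s: "0 < s" "s < 1"
  shows set_integrable_c_const: "set_integrable lborel {0<..} (\<lambda>y::real. y powr (1 - 2 * s) / (1 + y\<^sup>2))"
    and set_integral_c_const: "(LBINT y:{0<..}. y powr (1 - 2 * s) / (1 + y\<^sup>2)) = pi / (2 * sin (pi * s))"
proof -
  \<comment> \<open>The substitution \<open>t = y\<^sup>2 / (1 + y\<^sup>2)\<close> turns the integral into \<open>Beta (1 - s) s / 2\<close>.\<close>
  define f where "f t = t powr (- s) * (1 - t) powr (s - 1) / 2" for t :: real
  define g where "g y = y\<^sup>2 / (1 + y\<^sup>2)" for y :: real
  define g' where "g' y = 2 * y / (1 + y\<^sup>2)\<^sup>2" for y :: real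
  let ?h = "\<lambda>y::real. y powr (1 - 2 * s) / (1 + y\<^sup>2)"
  have nz: "1 + y\<^sup>2 > 0" for y :: real
    by (simp add: add_pos_nonneg)
  have img: "g ` {0<..} = {0<..<1}"
  proof (intro equalityI subsetI)
    fix t assume "t \<in> g ` {0<..}"
    then show "t \<in> {0<..<1}"
      using nz by (auto simp: g_def)
  next
    fix t :: real assume t: "t \<in> {0<..<1}"
    then have "1 + t / (1 - t) = 1 / (1 - t)"
      by (simp add: field_simps)
    with t have "t = g (sqrt (t / (1 - t)))"
      by (simp add: g_def)
    moreover have "sqrt (t / (1 - t)) \<in> {0<..}"
      using t by simp
    ultimately show "t \<in> g ` {0<..}"
      by blast
  qed
  have inj: "inj_on g {0<..}"
  proof (rule inj_onI)
    fix x y assume xy: "x \<in> {0<..}" "y \<in> {0<..}" "g x = g y"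
    then have "x\<^sup>2 * (1 + y\<^sup>2) = y\<^sup>2 * (1 + x\<^sup>2)"
      using nz[of x] nz[of y] by (simp add: g_def field_simps)
    then have "x\<^sup>2 = y\<^sup>2"
      by (simp add: algebra_simps)
    then show "x = y"
      using xy by (simp add: power2_eq_iff_nonneg)
  qed
  have deriv: "(g has_field_derivative g' y) (at y within {0<..})" for y
  proof -
    have num: "((\<lambda>y. y\<^sup>2) has_field_derivative 2 * y) (at y within {0<..})"
      and den: "((\<lambda>y. 1 + y\<^sup>2) has_field_derivative 2 * y) (at y within {0<..})"
      by (auto intro!: derivative_eq_intros)
    have "(g has_field_derivative (2 * y * (1 + y\<^sup>2) - y\<^sup>2 * (2 * y)) / ((1 + y\<^sup>2) * (1 + y\<^sup>2))) (at y within {0<..})"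
      unfolding g_def using nz[of y] by (intro DERIV_divide num den) simp
    also have "(2 * y * (1 + y\<^sup>2) - y\<^sup>2 * (2 * y)) / ((1 + y\<^sup>2) * (1 + y\<^sup>2)) = g' y"
      by (simp add: g'_def power2_eq_square algebra_simps)
    finally show ?thesis .
  qed
  \<comment> \<open>With t = g y, t^(-s) is y^(-2s) (1 + y^2)^s and (1 - t)^(s-1) is (1 +
    y^2)^(1-s). The powers of 1 + y^2 combine to exponent 1, and the derivative 2y / (1 + y^2)^2
    cancels the factor 1/2 in \<open>f\<close>.\<close>
  have eq: "\<bar>g' y\<bar> * f (g y) = ?h y" if "y \<in> {0<..}" for y
  proof -
    have y: "y > 0" using that by simp
    have "1 - g y = 1 / (1 + y\<^sup>2)"
      using nz[of y] by (simp add: g_def field_simps)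
    then have "f (g y) = (y\<^sup>2 / (1 + y\<^sup>2)) powr (- s) * (1 / (1 + y\<^sup>2)) powr (s - 1) / 2"
      by (simp add: f_def g_def)
    also have "\<dots> = (y\<^sup>2) powr (- s) * ((1 + y\<^sup>2) powr s * (1 + y\<^sup>2) powr (1 - s)) / 2"
      using nz[of y] y by (simp add: powr_divide powr_minus powr_diff field_simps)
    also have "(y\<^sup>2) powr (- s) = y powr (2 * (- s))"
      unfolding powr_powr[symmetric] using y by simp
    also have "(1 + y\<^sup>2) powr s * (1 + y\<^sup>2) powr (1 - s) = 1 + y\<^sup>2"
      using nz[of y] by (simp add: powr_add[symmetric])
    finally have fg: "f (g y) = y powr (2 * (- s)) * (1 + y\<^sup>2) / 2" .
    have "2 * y / q\<^sup>2 * (p * q / 2) = y * p / q" if "q > 0" for p q :: real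
      using that by (simp add: power2_eq_square)
    from this[OF nz[of y]] have "\<bar>g' y\<bar> * f (g y) = (y * y powr (2 * (- s))) / (1 + y\<^sup>2)"
      using y unfolding fg g'_def by simp
    also have "y * y powr (2 * (- s)) = y powr (1 - 2 * s)"
      using y by (simp add: powr_diff powr_minus field_simps)
    finally show ?thesis .
  qed
  have "((\<lambda>t. t powr (1 - s - 1) * (1 - t) powr (s - 1)) has_integral Beta (1 - s) s) {0..1}"
    using s by (intro has_integral_Beta_real) auto
  from has_integral_mult_right[OF this, of "1/2"]
  have f_int: "(f has_integral Beta (1 - s) s / 2) {0<..<1}"
    unfolding f_def by (simp add: has_integral_Icc_iff_Ioo)
  then have "f absolutely_integrable_on {0<..<1}"
    by (intro nonnegative_absolutely_integrable_1) (auto simp: f_def)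
  moreover have "integral {0<..<1} f = Beta (1 - s) s / 2"
    using f_int by (rule integral_unique)
  ultimately have "f absolutely_integrable_on g ` {0<..} \<and> integral (g ` {0<..}) f = Beta (1 - s) s / 2"
    unfolding img by simp
  then have "(\<lambda>y. \<bar>g' y\<bar> * f (g y)) absolutely_integrable_on {0<..} \<and>
      integral {0<..} (\<lambda>y. \<bar>g' y\<bar> * f (g y)) = Beta (1 - s) s / 2"
    by (subst has_absolute_integral_change_of_variables_1'[OF _ deriv inj]) auto
  moreover have "(\<lambda>y. indicator {0<..} y *\<^sub>R (\<bar>g' y\<bar> * f (g y))) = (\<lambda>y. indicator {0<..} y *\<^sub>R ?h y)"
    using eq by (auto simp: indicator_def)
  moreover have "integral {0<..} (\<lambda>y. \<bar>g' y\<bar> * f (g y)) = integral {0<..} ?h"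
    by (rule Henstock_Kurzweil_Integration.integral_cong[OF eq])
  ultimately have h: "integrable lebesgue (\<lambda>y. indicator {0<..} y *\<^sub>R ?h y)" "integral {0<..} ?h = Beta (1 - s) s / 2"
    by (simp_all only: set_integrable_def)
  \<comment> \<open>The change of variables is a statement about the completed measure; the
    integrand is Borel, so integrability passes to \<open>lborel\<close>.\<close>
  note h(1)
  then show *: "set_integrable lborel {0<..} ?h"
    unfolding set_integrable_def by (subst (asm) integrable_completion) auto
  \<comment> \<open>Euler's reflection formula, taken from the complex Gamma function.\<close>
  have "Beta (1 - s) s = pi / sin (pi * s)"
  proof -
    have "complex_of_real (Gamma s * Gamma (1 - s)) = Gamma (complex_of_real s) * Gamma (1 - complex_of_real s)"
      unfolding of_real_mult Gamma_complex_of_real[symmetric] of_real_diff of_real_1 ..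
    also have "\<dots> = complex_of_real pi / sin (complex_of_real pi * complex_of_real s)"
      by (rule Gamma_reflection_complex)
    also have "\<dots> = complex_of_real (pi / sin (pi * s))"
      unfolding of_real_divide sin_of_real[symmetric] of_real_mult ..
    finally have "Gamma s * Gamma (1 - s) = pi / sin (pi * s)"
      by (simp only: of_real_eq_iff)
    then show ?thesis
      by (simp add: Beta_def mult.commute)
  qed
  then show "(LBINT y:{0<..}. ?h y) = pi / (2 * sin (pi * s))"
    using set_borel_integral_eq_integral(2)[OF *] h(2) by simp
qed

lemma
  fixes s \<rho> :: real
  assumes s: "0 < s" "s < 1" and \<rho>: "\<rho> \<ge> 0"
  shows integrable_resolvent_kernel:
      "integrable lborel (\<lambda>t. indicator {0<..} t * (t powr (1 - 2 * s) * (\<rho>\<^sup>2 / (1 + t\<^sup>2 * \<rho>\<^sup>2))))" (is ?A)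
    and integral_resolvent_kernel:
      "c_const s * (LBINT t. indicator {0<..} t * (t powr (1 - 2 * s) * (\<rho>\<^sup>2 / (1 + t\<^sup>2 * \<rho>\<^sup>2)))) = \<rho> powr (2 * s)" (is ?B)
proof -
  define H where "H y = indicator {0<..} y * (y powr (1 - 2 * s) / (1 + y\<^sup>2))" for y :: real
  have H: "integrable lborel H"
    using set_integrable_c_const[OF s] by (simp add: set_integrable_def H_def[abs_def])
  have cH: "c_const s * (LBINT y. H y) = 1"
  proof -
    \<comment> \<open>The integral must be nonzero for \<open>inverse\<close> in
      \<open>c_const\<close> to be a genuine reciprocal.\<close>
    have "sin (pi * s) > 0"
      using s by (intro sin_gt_zero) auto
    then show ?thesis
      using set_integral_c_const[OF s]
      by (simp add: c_const_def set_lebesgue_integral_def H_def)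
  qed
  have "?A \<and> ?B"
  proof (cases "\<rho> = 0")
    case True
    \<comment> \<open>Both sides are 0, the right one because \<open>0 powr (2 * s)\<close> is
      0.\<close>
    then show ?thesis by simp
  next
    case False
    with \<rho> have pos: "\<rho> > 0" by simp
    \<comment> \<open>The scaling \<open>y = \<rho> t\<close> reduces the integral to \<open>\<rho> = 1\<close>.\<close>
    have eq: "indicator {0<..} t * (t powr (1 - 2 * s) * (\<rho>\<^sup>2 / (1 + t\<^sup>2 * \<rho>\<^sup>2))) = \<rho> powr (1 + 2 * s) * H (0 + \<rho> * t)" for t
    proof (cases "t > 0")
      case True
      \<comment> \<open>The factor with exponent 1 - 2s turns the power of t into one of \<rho> t.
        Of the other factor, one power of \<rho> pays for the scaling of the measure, which leaves
        |\<rho>|^(2s).\<close>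
      have "\<rho>\<^sup>2 = \<rho> powr (1 + 2 * s) * \<rho> powr (1 - 2 * s)"
        using pos by (simp add: powr_add[symmetric])
      then show ?thesis
        using True pos by (simp add: H_def powr_mult power_mult_distrib mult_ac)
    qed (use pos in \<open>simp add: H_def zero_less_mult_iff\<close>)
    have "(LBINT y. H y) = \<rho> * (LBINT t. H (0 + \<rho> * t))"
      using lborel_integral_real_affine[of \<rho> H 0] pos by simp
    then have "\<rho> powr (1 + 2 * s) * (LBINT t. H (0 + \<rho> * t)) = \<rho> powr (2 * s) * (LBINT y. H y)"
      using pos by (simp add: powr_add)
    then show ?thesis
      unfolding eq using lborel_integrable_real_affine[OF H, of \<rho> 0] pos cH
      by (simp add: mult.left_commute)
  qed
  then show ?A ?B by auto
qed

section \<open>The operators on the frequency side\<close>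

lemma
  assumes \<sigma>: "0 \<le> \<sigma>" and f: "f \<in> sobolev (2 * \<sigma>)"
  shows L2_frac_laplacian_symbol: "(\<lambda>\<zeta>. complex_of_real (norm \<zeta> powr (2 * \<sigma>)) * fourier f \<zeta>) \<in> L2"
    and L2_frac_laplacian: "frac_laplacian \<sigma> f \<in> L2"
    and fourier_frac_laplacian:
      "AE \<zeta> in lborel. fourier (frac_laplacian \<sigma> f) \<zeta> = complex_of_real (norm \<zeta> powr (2 * \<sigma>)) * fourier f \<zeta>"
proof -
  have f_L2: "f \<in> L2" and S: "(\<lambda>\<zeta>. complex_of_real ((1 + (norm \<zeta>)\<^sup>2) powr \<sigma>) * fourier f \<zeta>) \<in> L2"
    using f by (auto simp: sobolev_def)
  note [measurable] = f_L2[THEN L2_fourier, THEN L2_measurable]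
  show *: "(\<lambda>\<zeta>. complex_of_real (norm \<zeta> powr (2 * \<sigma>)) * fourier f \<zeta>) \<in> L2"
  proof (rule L2_dominated[OF S])
    fix \<zeta> :: 'a
    \<comment> \<open>The symbol is at most (1 + |\<zeta>|^2)^\<sigma>, so the Sobolev space of
      order 2 \<sigma> lies in the domain of the operator.\<close>
    have "norm \<zeta> powr (2 * \<sigma>) = (norm \<zeta>)\<^sup>2 powr \<sigma>"
      by (cases "\<zeta> = 0") (simp_all add: powr_powr[symmetric])
    also have "\<dots> \<le> (1 + (norm \<zeta>)\<^sup>2) powr \<sigma>"
      using \<sigma> by (intro powr_mono2) auto
    finally show "cmod (complex_of_real (norm \<zeta> powr (2 * \<sigma>)) * fourier f \<zeta>)
        \<le> cmod (complex_of_real ((1 + (norm \<zeta>)\<^sup>2) powr \<sigma>) * fourier f \<zeta>)"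
      by (simp add: norm_mult mult_right_mono)
  qed measurable
  show "frac_laplacian \<sigma> f \<in> L2"
    "AE \<zeta> in lborel. fourier (frac_laplacian \<sigma> f) \<zeta> = complex_of_real (norm \<zeta> powr (2 * \<sigma>)) * fourier f \<zeta>"
    unfolding frac_laplacian_def using L2_fourier_multiplier[OF *] fourier_fourier_multiplier[OF *] by auto
qed

text \<open>The composite symbol is bounded by 1 / t^2, so the resolvent maps all of L2 into the
  domain of the Laplacian; hence \<open>\<eta>\<close> and \<open>\<theta>\<close> only need to be
  in L2.\<close>

lemma L2_inner_laplacian_resolvent:
  fixes \<eta> \<theta> :: "'a::euclidean_space \<Rightarrow> complex"
  assumes \<eta>: "\<eta> \<in> L2" and \<theta>: "\<theta> \<in> L2" and t: "t > 0"
  shows "L2_inner (frac_laplacian 1 (laplace_resolvent t \<eta>)) \<theta>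
    = (LBINT \<zeta>. complex_of_real ((norm \<zeta>)\<^sup>2 / (1 + t\<^sup>2 * (norm \<zeta>)\<^sup>2)) * (fourier \<eta> \<zeta> * cnj (fourier \<theta> \<zeta>)))"
proof -
  note [measurable] = \<eta>[THEN L2_fourier, THEN L2_measurable] \<theta>[THEN L2_fourier, THEN L2_measurable]
  let ?m = "\<lambda>\<zeta>::'a. inverse (1 + t\<^sup>2 * (norm \<zeta>)\<^sup>2)"
  have pos: "1 + t\<^sup>2 * (norm \<zeta>)\<^sup>2 > 0" for \<zeta> :: 'a
    by (simp add: add_pos_nonneg)
  have "(\<lambda>\<zeta>. complex_of_real (?m \<zeta>) * fourier \<eta> \<zeta>) \<in> L2"
  proof (rule L2_dominated[OF L2_fourier[OF \<eta>]])
    fix \<zeta> :: 'a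
    have "?m \<zeta> \<le> 1"
      by (rule inverse_le_1_iff[THEN iffD2]) simp
    then show "cmod (complex_of_real (?m \<zeta>) * fourier \<eta> \<zeta>) \<le> cmod (fourier \<eta> \<zeta>)"
      using pos[of \<zeta>] unfolding norm_mult norm_of_real by (intro mult_left_le_one_le) auto
  qed measurable
  note R = L2_fourier_multiplier[OF this, folded laplace_resolvent_def]
    fourier_fourier_multiplier[OF this, folded laplace_resolvent_def]
  note [measurable] = R(1)[THEN L2_fourier, THEN L2_measurable]
  \<comment> \<open>The origin is treated separately: there \<open>powr\<close> gives 0, in
    agreement with the square.\<close>
  have p2: "norm \<zeta> powr (2 * 1) = (norm \<zeta>)\<^sup>2" for \<zeta> :: 'a
    by (cases "\<zeta> = 0") simp_all
  have "(\<lambda>\<zeta>. complex_of_real (norm \<zeta> powr (2 * 1)) * fourier (laplace_resolvent t \<eta>) \<zeta>) \<in> L2"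
  proof (rule L2_dominated_AE[OF L2_fourier[OF \<eta>]])
    show "AE \<zeta> in lborel. cmod (complex_of_real (norm \<zeta> powr (2 * 1)) * fourier (laplace_resolvent t \<eta>) \<zeta>)
        \<le> (1 / t\<^sup>2) * cmod (fourier \<eta> \<zeta>)"
      using R(2)
    proof eventually_elim
      case (elim \<zeta>)
      have "(norm \<zeta>)\<^sup>2 * ?m \<zeta> \<le> 1 / t\<^sup>2"
        using pos[of \<zeta>] t by (simp add: field_simps)
      then have "((norm \<zeta>)\<^sup>2 * ?m \<zeta>) * cmod (fourier \<eta> \<zeta>) \<le> (1 / t\<^sup>2) * cmod (fourier \<eta> \<zeta>)"
        by (rule mult_right_mono) simp
      moreover have "cmod (complex_of_real (norm \<zeta> powr (2 * 1)) * fourier (laplace_resolvent t \<eta>) \<zeta>)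
          = ((norm \<zeta>)\<^sup>2 * ?m \<zeta>) * cmod (fourier \<eta> \<zeta>)"
        unfolding elim p2 norm_mult norm_of_real using pos[of \<zeta>] by simp
      ultimately show ?case by simp
    qed
  qed measurable
  note F = L2_fourier_multiplier[OF this, folded frac_laplacian_def]
    fourier_fourier_multiplier[OF this, folded frac_laplacian_def]
  note [measurable] = F(1)[THEN L2_fourier, THEN L2_measurable]
  have "L2_inner (frac_laplacian 1 (laplace_resolvent t \<eta>)) \<theta>
      = (LBINT \<zeta>. fourier (frac_laplacian 1 (laplace_resolvent t \<eta>)) \<zeta> * cnj (fourier \<theta> \<zeta>))"
    using fourier_Parseval[OF F(1) \<theta>] by (simp add: L2_inner_def)
  also have "\<dots> = (LBINT \<zeta>. complex_of_real ((norm \<zeta>)\<^sup>2 / (1 + t\<^sup>2 * (norm \<zeta>)\<^sup>2)) * (fourier \<eta> \<zeta> * cnj (fourier \<theta> \<zeta>)))"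
  proof (rule Bochner_Integration.integral_cong_AE)
    show "AE \<zeta> in lborel. fourier (frac_laplacian 1 (laplace_resolvent t \<eta>)) \<zeta> * cnj (fourier \<theta> \<zeta>)
        = complex_of_real ((norm \<zeta>)\<^sup>2 / (1 + t\<^sup>2 * (norm \<zeta>)\<^sup>2)) * (fourier \<eta> \<zeta> * cnj (fourier \<theta> \<zeta>))"
      using F(2) R(2) by eventually_elim (simp only: p2, simp add: divide_inverse mult.assoc)
  qed measurable
  finally show ?thesis .
qed

text \<open>Only the sum of the two orders enters the weight, which is why r disappears from the
  result. Integrability comes from giving each L2 factor its own share of the weight.\<close>

lemma
  fixes \<eta> \<theta> :: "'a::euclidean_space \<Rightarrow> complex"
  assumes "0 \<le> \<sigma>" "0 \<le> \<tau>" and \<eta>: "\<eta> \<in> sobolev (2 * \<sigma>)" and \<theta>: "\<theta> \<in> sobolev (2 * \<tau>)"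
  shows integrable_frac_laplacian_symbols:
      "integrable lborel (\<lambda>\<zeta>. complex_of_real (norm \<zeta> powr (2 * (\<sigma> + \<tau>))) * (fourier \<eta> \<zeta> * cnj (fourier \<theta> \<zeta>)))"
    and L2_inner_frac_laplacian: "L2_inner (frac_laplacian \<sigma> \<eta>) (frac_laplacian \<tau> \<theta>)
      = (LBINT \<zeta>. complex_of_real (norm \<zeta> powr (2 * (\<sigma> + \<tau>))) * (fourier \<eta> \<zeta> * cnj (fourier \<theta> \<zeta>)))"
proof -
  let ?P = "\<lambda>\<zeta>. complex_of_real (norm \<zeta> powr (2 * (\<sigma> + \<tau>))) * (fourier \<eta> \<zeta> * cnj (fourier \<theta> \<zeta>))"
  let ?E = "\<lambda>\<zeta>. complex_of_real (norm \<zeta> powr (2 * \<sigma>)) * fourier \<eta> \<zeta>"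
  let ?T = "\<lambda>\<zeta>. complex_of_real (norm \<zeta> powr (2 * \<tau>)) * fourier \<theta> \<zeta>"
  note E = L2_frac_laplacian_symbol[OF assms(1) \<eta>] and T = L2_frac_laplacian_symbol[OF assms(2) \<theta>]
  have eq: "?E \<zeta> * cnj (?T \<zeta>) = ?P \<zeta>" for \<zeta>
    by (simp add: powr_add distrib_left mult_ac)
  from L2_inner_integrable[OF E T] show "integrable lborel ?P"
    unfolding eq .
  note [measurable] = E[THEN L2_measurable] T[THEN L2_measurable]
    L2_frac_laplacian[OF assms(1) \<eta>, THEN L2_fourier, THEN L2_measurable]
    L2_frac_laplacian[OF assms(2) \<theta>, THEN L2_fourier, THEN L2_measurable]
  have "L2_inner (frac_laplacian \<sigma> \<eta>) (frac_laplacian \<tau> \<theta>)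
      = L2_inner (fourier (frac_laplacian \<sigma> \<eta>)) (fourier (frac_laplacian \<tau> \<theta>))"
    by (rule fourier_Parseval[symmetric]) (intro L2_frac_laplacian assms)+
  also have "\<dots> = (LBINT \<zeta>. ?E \<zeta> * cnj (?T \<zeta>))"
    unfolding L2_inner_def
  proof (rule Bochner_Integration.integral_cong_AE)
    show "AE \<zeta> in lborel. fourier (frac_laplacian \<sigma> \<eta>) \<zeta> * cnj (fourier (frac_laplacian \<tau> \<theta>) \<zeta>) = ?E \<zeta> * cnj (?T \<zeta>)"
      using fourier_frac_laplacian[OF assms(1) \<eta>] fourier_frac_laplacian[OF assms(2) \<theta>] by eventually_elim simp
  qed measurable
  finally show "L2_inner (frac_laplacian \<sigma> \<eta>) (frac_laplacian \<tau> \<theta>) = (LBINT \<zeta>. ?P \<zeta>)"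
    unfolding eq .
qed

section \<open>Exchange of the integrals over frequency and t\<close>

theorem theorem4p1:
  fixes \<eta> \<theta> :: "'a::euclidean_space \<Rightarrow> complex" and s r :: real
  assumes "0 < s" "s < 1" "0 \<le> r" "r \<le> s"
    and "\<eta> \<in> sobolev (s + r)" and "\<theta> \<in> sobolev (s - r)"
  shows "set_integrable lborel {0<..} (\<lambda>t.
           complex_of_real (t powr (2 - 2 * s)) *
           L2_inner (frac_laplacian 1 (laplace_resolvent t \<eta>)) \<theta> / complex_of_real t) \<and>
         L2_inner (frac_laplacian ((s + r) / 2) \<eta>) (frac_laplacian ((s - r) / 2) \<theta>) =
         complex_of_real (c_const s) *
         (LBINT t:{0<..}. complex_of_real (t powr (2 - 2 * s)) *
           L2_inner (frac_laplacian 1 (laplace_resolvent t \<eta>)) \<theta> / complex_of_real t) \<and>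
         set_integrable lborel {0<..} (\<lambda>y::real. y powr (1 - 2 * s) / (1 + y\<^sup>2)) \<and>
         c_const s = 2 * sin (pi * s) / pi"
proof (intro conjI)
  let ?I = "\<lambda>t. complex_of_real (t powr (2 - 2 * s)) *
    L2_inner (frac_laplacian 1 (laplace_resolvent t \<eta>)) \<theta> / complex_of_real t"
  show "set_integrable lborel {0<..} (\<lambda>y::real. y powr (1 - 2 * s) / (1 + y\<^sup>2))"
    using assms by (intro set_integrable_c_const)
  show c: "c_const s = 2 * sin (pi * s) / pi"
    using assms by (simp add: c_const_def set_integral_c_const)
  have "sin (pi * s) > 0"
    using assms by (intro sin_gt_zero) auto
  then have c_pos: "c_const s > 0"
    unfolding c by simp
  have \<eta>: "\<eta> \<in> L2" and \<theta>: "\<theta> \<in> L2"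
    using assms by (auto simp: sobolev_def)
  note [measurable] = \<eta>[THEN L2_fourier, THEN L2_measurable] \<theta>[THEN L2_fourier, THEN L2_measurable]
  interpret lborel_pair: pair_sigma_finite "lborel :: 'a measure" "lborel :: real measure" ..
  \<comment> \<open>Dividing by t lowers the exponent 2 - 2s to 1 - 2s; the indicator lets t range
    over the whole line, so that Fubini applies to a product of two Lebesgue measures.\<close>
  define K :: "'a \<Rightarrow> real \<Rightarrow> real" where
    "K \<zeta> t = indicator {0<..} t * (t powr (1 - 2 * s) * ((norm \<zeta>)\<^sup>2 / (1 + t\<^sup>2 * (norm \<zeta>)\<^sup>2)))" for \<zeta> t
  define P where "P \<zeta> = fourier \<eta> \<zeta> * cnj (fourier \<theta> \<zeta>)" for \<zeta>
  have [measurable]: "(\<lambda>x. K (fst x) (snd x)) \<in> borel_measurable (borel \<Otimes>\<^sub>M borel)"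
    unfolding K_def by measurable
  have [measurable]: "P \<in> borel_measurable borel"
    unfolding P_def by measurable
  have K_nonneg: "K \<zeta> t \<ge> 0" for \<zeta> t
    by (simp add: K_def)
  have K_int: "integrable lborel (K \<zeta>)" and K_val: "c_const s * (LBINT t. K \<zeta> t) = norm \<zeta> powr (2 * s)" for \<zeta>
    unfolding K_def[abs_def]
    using integrable_resolvent_kernel[OF assms(1,2), of "norm \<zeta>"] integral_resolvent_kernel[OF assms(1,2), of "norm \<zeta>"]
    by simp_all
  have K_val': "(LBINT t. K \<zeta> t) = norm \<zeta> powr (2 * s) / c_const s" for \<zeta>
    using K_val[of \<zeta>] c_pos by (simp add: field_simps)
  have "2 * ((s + r) / 2) = s + r" "2 * ((s - r) / 2) = s - r"
    by simp_all
  then have "\<eta> \<in> sobolev (2 * ((s + r) / 2))" "\<theta> \<in> sobolev (2 * ((s - r) / 2))"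
    using assms(5,6) by (simp_all only:)
  note symb = integrable_frac_laplacian_symbols[OF _ _ this] L2_inner_frac_laplacian[OF _ _ this]
  have s_eq: "2 * ((s + r) / 2 + (s - r) / 2) = 2 * s"
    by (simp add: field_simps)
  have P_int: "integrable lborel (\<lambda>\<zeta>. complex_of_real (norm \<zeta> powr (2 * s)) * P \<zeta>)"
    using symb(1) assms(3,4) unfolding s_eq P_def by simp
  have lhs: "L2_inner (frac_laplacian ((s + r) / 2) \<eta>) (frac_laplacian ((s - r) / 2) \<theta>)
      = (LBINT \<zeta>. complex_of_real (norm \<zeta> powr (2 * s)) * P \<zeta>)"
    using symb(2) assms(1,3,4) unfolding s_eq P_def by simp
  have pair_int: "integrable (lborel \<Otimes>\<^sub>M lborel) (\<lambda>(\<zeta>, t). complex_of_real (K \<zeta> t) * P \<zeta>)"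
  proof (rule lborel_pair.Fubini_integrable)
    show "(\<lambda>(\<zeta>, t). complex_of_real (K \<zeta> t) * P \<zeta>) \<in> borel_measurable (lborel \<Otimes>\<^sub>M lborel)"
      unfolding case_prod_beta by measurable
    \<comment> \<open>Since \<open>K\<close> is nonnegative, the inner integral of the modulus is
      computed exactly by the kernel formula, and \<open>P_int\<close> makes it integrable in
      \<zeta>.\<close>
    have "(LBINT t. norm (case (\<zeta>, t) of (\<zeta>, t) \<Rightarrow> complex_of_real (K \<zeta> t) * P \<zeta>))
        = norm (complex_of_real (norm \<zeta> powr (2 * s)) * P \<zeta>) / c_const s" for \<zeta>
      using K_nonneg by (simp add: norm_mult K_val')
    then show "integrable lborel (\<lambda>\<zeta>. LBINT t. norm (case (\<zeta>, t) of (\<zeta>, t) \<Rightarrow> complex_of_real (K \<zeta> t) * P \<zeta>))"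
      using integrable_norm[OF P_int] by (simp only:) (rule Bochner_Integration.integrable_divide)
    show "AE \<zeta> in lborel. integrable lborel (\<lambda>t. case (\<zeta>, t) of (\<zeta>, t) \<Rightarrow> complex_of_real (K \<zeta> t) * P \<zeta>)"
      using K_int by (auto intro!: AE_I2 Bochner_Integration.integrable_mult_left)
  qed
  \<comment> \<open>The operator formula is available only for positive t; otherwise both sides are
    0.\<close>
  have ind: "indicator {0<..} t *\<^sub>R ?I t = (LBINT \<zeta>. complex_of_real (K \<zeta> t) * P \<zeta>)" for t
  proof (cases "t > 0")
    case True
    have "t powr (2 - 2 * s) = t * t powr (1 - 2 * s)"
      using True powr_add[of t 1 "1 - 2 * s"] by simp
    then have "?I t = complex_of_real (t powr (1 - 2 * s)) *
        (LBINT \<zeta>. complex_of_real ((norm \<zeta>)\<^sup>2 / (1 + t\<^sup>2 * (norm \<zeta>)\<^sup>2)) * P \<zeta>)"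
      using True by (simp add: L2_inner_laplacian_resolvent[OF \<eta> \<theta> True] P_def)
    also have "\<dots> = (LBINT \<zeta>. complex_of_real (t powr (1 - 2 * s)) *
        (complex_of_real ((norm \<zeta>)\<^sup>2 / (1 + t\<^sup>2 * (norm \<zeta>)\<^sup>2)) * P \<zeta>))"
      by (rule integral_mult_right_zero[symmetric])
    also have "\<dots> = (LBINT \<zeta>. complex_of_real (K \<zeta> t) * P \<zeta>)"
      using True by (simp add: K_def mult.assoc)
    finally show ?thesis
      using True by simp
  qed (simp add: K_def)
  \<comment> \<open>The integral of a non-integrable function is 0 by default, so integrability is
    what makes the right-hand side a genuine integral.\<close>
  show "set_integrable lborel {0<..} ?I"
    unfolding set_integrable_def ind by (rule lborel_pair.integrable_snd[OF pair_int])
  have "complex_of_real (c_const s) * (LBINT t:{0<..}. ?I t)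
      = complex_of_real (c_const s) * (LBINT t. LBINT \<zeta>. complex_of_real (K \<zeta> t) * P \<zeta>)"
    unfolding set_lebesgue_integral_def ind ..
  also have "(LBINT t. LBINT \<zeta>. complex_of_real (K \<zeta> t) * P \<zeta>) = (LBINT \<zeta>. LBINT t. complex_of_real (K \<zeta> t) * P \<zeta>)"
    by (rule lborel_pair.Fubini_integral[OF pair_int])
  also have "complex_of_real (c_const s) * \<dots> = (LBINT \<zeta>. complex_of_real (c_const s) * (LBINT t. complex_of_real (K \<zeta> t) * P \<zeta>))"
    by (rule integral_mult_right_zero[symmetric])
  also have "\<dots> = (LBINT \<zeta>. complex_of_real (norm \<zeta> powr (2 * s)) * P \<zeta>)"
    using K_val by (simp add: integral_complex_of_real mult.assoc[symmetric] flip: of_real_mult)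
  finally show "L2_inner (frac_laplacian ((s + r) / 2) \<eta>) (frac_laplacian ((s - r) / 2) \<theta>)
      = complex_of_real (c_const s) * (LBINT t:{0<..}. ?I t)"
    unfolding lhs by simp
qed

end
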